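(* Let $d\ge1$, $\alpha_i\in(1,2)$, $K_i>0$ for $i=1,\dots,d$, let $\Omega=\prod_{i=1}^d(\check a_i,\hat a_i)\subset\mathbb{R}^d$, let $T_f>0$, and let $r:\Omega\times(0,T_f]\to\mathbb{R}$ be bounded above and bounded below by a positive constant. Let $M,n_1,\dots,n_d$ be positive integers, $m\in\{0,\dots,M-1\}$, and let $D^{m+\frac12}$, $T$, $\hat r^{m+\frac12}$, $\check r^{m+\frac12}$, $\bar r^{m+\frac12}$ and the preconditioner $P_\tau=P_\tau^{m+1}=\bar r^{m+\frac12}I+\tau(T)$ be as defined in the context. Then every eigenvalue $\lambda$ of the matrix $P_\tau^{-1}(D^{m+\frac12}+T)$ satisfies $$\min\left\{\frac{\check r^{m+\frac12}}{\hat r^{m+\frac12}},\frac38\right\}\le\lambda\le\max\left\{\frac{\hat r^{m+\frac12}}{\check r^{m+\frac12}},2\right\}.$$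
   Context: Mesh: $\Delta t=T_f/M$, $t_{m+\frac12}=(m+\frac12)\Delta t$, $h_i=(\hat a_i-\check a_i)/(n_i+1)$, grid points $\boldsymbol{x}_{\boldsymbol{J}}=(\check a_1+j_1h_1,\dots,\check a_d+j_dh_d)$, $1\le j_i\le n_i$, ordered with the last index $j_d$ varying fastest. $D^{m+\frac12}$ is the diagonal matrix with diagonal entries $r(\boldsymbol{x}_{\boldsymbol{J}},t_{m+\frac12})$ in this order. Notation: $n_i^-=\prod_{j=1}^{i-1}n_j$, $n_i^+=\prod_{j=i+1}^dn_j$ (empty products are $1$), $\eta_i=\frac{K_i\Delta t}{2h_i^{\alpha_i}}>0$, $I_n$ the $n\times n$ identity, $\otimes$ the Kronecker product. Matrix $T$: for $\alpha\in(1,2)$, $k\in\mathbb{Z}$, let $$\hat s_k^{(\alpha)}=\frac{(-1)^k\Gamma(\alpha+1)}{\Gamma(\frac{\alpha}{2}-k+1)\Gamma(\frac{\alpha}{2}+k+1)},\qquad s_k^{(\alpha)}=\hat s_k^{(\alpha)}\left[1+\frac{\alpha(\alpha+1)(\alpha+2)}{6(\alpha-2k+2)(\alpha+2k+2)}\right],$$ which are the Fourier coefficients of $(2-2\cos\theta)^{\alpha/2}$ and of $[1+\frac{\alpha}{24}(2-2\cos\theta)](2-2\cos\theta)^{\alpha/2}$ respectively. Let $\hat S_n^{(\alpha)}=[\hat s_{j-k}^{(\alpha)}]_{j,k=1}^n$ and $S_n^{(\alpha)}=[s_{j-k}^{(\alpha)}]_{j,k=1}^n$ (symmetric Toeplitz),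 and $$T=\sum_{i=1}^d\eta_i\,I_{n_i^-}\otimes S_{n_i}^{(\alpha_i)}\otimes I_{n_i^+}.$$ Natural $\tau$ matrix: for a symmetric Toeplitz matrix $A=[a_{|j-k|}]_{j,k=1}^n$, $\tau(A)=A-H(A)$, where $H(A)$ is the Hankel matrix with entries $H(A)_{jk}=a_{j+k}$ if $j+k\le n-1$, $H(A)_{jk}=a_{2n+2-j-k}$ if $j+k\ge n+3$, and $H(A)_{jk}=0$ otherwise. (Such matrices are diagonalized by the discrete sine transform matrix.) Preconditioner: $P_{\alpha_i}=Q_{n_i}\,\tau(\hat S_{n_i}^{(\alpha_i)})$, where $Q_{n_i}=I_{n_i}+\frac{\alpha_i}{24}\,\mathrm{tridiag}(-1,2,-1)\in\mathbb{R}^{n_i\times n_i}$; $$\tau(T)=\sum_{i=1}^d\eta_i\,I_{n_i^-}\otimes P_{\alpha_i}\otimes I_{n_i^+},\qquad P_\tau=P_\tau^{m+1}=\bar r^{m+\frac12}I+\tau(T).$$ Here $\hat r^{m+\frac12}=\sup_{\boldsymbol{x}\in\Omega}r(\boldsymbol{x},t_{m+\frac12})$, $\check r^{m+\frac12}=\inf_{\boldsymbol{x}\in\Omega}r(\boldsymbol{x},t_{m+\frac12})$ (both positive and finite), and $\bar r^{m+\frac12}$ is any average of these, i.e. any number with $\check r^{m+\frac12}\le\bar r^{m+\frac12}\le\hat r^{m+\frac12}$, for example $\sqrt{\hat r^{m+\frac12}\check r^{m+\frac12}}$ or $\frac12(\hat r^{m+\frac12}+\check r^{m+\frac12})$. The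 matrix $P_\tau$ is symmetric positive definite, hence invertible. *)

theory Defs
  imports
    "HOL-Analysis.Gamma_Function"
    "HOL-Library.FuncSet"
    "Jordan_Normal_Form.Gauss_Jordan_Elimination"
    "Jordan_Normal_Form.Char_Poly"
begin

text \<open>
  Spatial directions are numbered \<open>1, \<dots>, d\<close>, and points of the \<open>d\<close>-dimensional space are
  functions on \<open>{1..d}\<close>, extensional in the sense of \<open>PiE\<close>.  Matrix rows and columns are
  numbered from 0, so the row \<open>j\<close> of the literature is row \<open>j - 1\<close> here.
\<close>

subsection \<open>Kronecker products and sums over the directions\<close>

definition kron :: "'a :: times mat \<Rightarrow> 'a mat \<Rightarrow> 'a mat" where
  "kron A B = mat (dim_row A * dim_row B) (dim_col A * dim_col B)
     (\<lambda>(p, q). A $$ (p div dim_row B, q div dim_col B) * B $$ (p mod dim_row B, q mod dim_col B))"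

definition size_below :: "(nat \<Rightarrow> nat) \<Rightarrow> nat \<Rightarrow> nat" where
  "size_below n i = (\<Prod>j\<in>{1..<i}. n j)"

definition size_above :: "nat \<Rightarrow> (nat \<Rightarrow> nat) \<Rightarrow> nat \<Rightarrow> nat" where
  "size_above d n i = (\<Prod>j\<in>{i<..d}. n j)"

definition total_size :: "nat \<Rightarrow> (nat \<Rightarrow> nat) \<Rightarrow> nat" where
  "total_size d n = (\<Prod>j\<in>{1..d}. n j)"

text \<open>
  The sum over \<open>i\<close> of \<open>c i\<close> times \<open>I \<otimes> A i \<otimes> I\<close>, written entrywise because matrices of
  non-fixed dimension form no additive monoid.  If each \<open>A i\<close> is \<open>n i\<close> by \<open>n i\<close>, then all
  summands are square of dimension \<open>total_size d n\<close>.
\<close>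

definition directional_sum ::
  "nat \<Rightarrow> (nat \<Rightarrow> nat) \<Rightarrow> (nat \<Rightarrow> real) \<Rightarrow> (nat \<Rightarrow> real mat) \<Rightarrow> real mat" where
  "directional_sum d n c A = mat (total_size d n) (total_size d n)
     (\<lambda>(p, q). \<Sum>i\<in>{1..d}.
        (c i \<cdot>\<^sub>m kron (kron (1\<^sub>m (size_below n i)) (A i)) (1\<^sub>m (size_above d n i))) $$ (p, q))"

subsection \<open>Toeplitz matrices and the natural tau matrix\<close>

text \<open>For \<open>1 < \<alpha> < 2\<close> no argument of \<open>Gamma\<close> is a pole and no denominator vanishes.\<close>

definition s_hat :: "real \<Rightarrow> int \<Rightarrow> real" where
  "s_hat \<alpha> k = ((-1) powi k) * Gamma (\<alpha> + 1) /
     (Gamma (\<alpha> / 2 - of_int k + 1) * Gamma (\<alpha> / 2 + of_int k + 1))"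

definition s_coeff :: "real \<Rightarrow> int \<Rightarrow> real" where
  "s_coeff \<alpha> k = s_hat \<alpha> k *
     (1 + \<alpha> * (\<alpha> + 1) * (\<alpha> + 2) /
        (6 * (\<alpha> - 2 * of_int k + 2) * (\<alpha> + 2 * of_int k + 2)))"

definition toeplitz :: "nat \<Rightarrow> (int \<Rightarrow> real) \<Rightarrow> real mat" where
  "toeplitz n a = mat n n (\<lambda>(j, k). a (int j - int k))"

definition S_hat_mat :: "nat \<Rightarrow> real \<Rightarrow> real mat" where
  "S_hat_mat n \<alpha> = toeplitz n (s_hat \<alpha>)"

definition S_mat :: "nat \<Rightarrow> real \<Rightarrow> real mat" where
  "S_mat n \<alpha> = toeplitz n (s_coeff \<alpha>)"

text \<open>
  The Hankel correction of a symmetric Toeplitz matrix with entries \<open>a \<bar>j - k\<bar>\<close>, where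
  \<open>a l\<close> is read off the first column.  With indices numbered from 1, \<open>l\<close> below is the sum of the
  row index and the column index.
\<close>

definition hankel_correction :: "real mat \<Rightarrow> real mat" where
  "hankel_correction A = (let n = dim_row A; a = (\<lambda>l. A $$ (l, 0)) in
     mat n n (\<lambda>(p, q). let l = (p + 1) + (q + 1) in
       if l \<le> n - 1 then a l
       else if l \<ge> n + 3 then a (2 * n + 2 - l)
       else 0))"

definition natural_tau :: "real mat \<Rightarrow> real mat" where
  "natural_tau A = A - hankel_correction A"

definition tridiag :: "nat \<Rightarrow> real \<Rightarrow> real \<Rightarrow> real \<Rightarrow> real mat" where
  "tridiag n l c u = mat n n (\<lambda>(p, q).
     if p = q then c else if p = q + 1 then l else if q = p + 1 then u else 0)"

definition Q_mat :: "nat \<Rightarrow> real \<Rightarrow> real mat" where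
  "Q_mat n \<alpha> = 1\<^sub>m n + (\<alpha> / 24) \<cdot>\<^sub>m tridiag n (-1) 2 (-1)"

definition P_alpha :: "nat \<Rightarrow> real \<Rightarrow> real mat" where
  "P_alpha n \<alpha> = Q_mat n \<alpha> * natural_tau (S_hat_mat n \<alpha>)"

subsection \<open>The mesh\<close>

text \<open>
  In all that follows, \<open>a\<close> and \<open>b\<close> are the families of lower and upper endpoints of the box,
  \<open>Tf\<close> is the final time, \<open>M\<close> the number of time steps and \<open>n i\<close> the number of interior grid
  points in direction \<open>i\<close>.
\<close>

definition box_domain :: "nat \<Rightarrow> (nat \<Rightarrow> real) \<Rightarrow> (nat \<Rightarrow> real) \<Rightarrow> (nat \<Rightarrow> real) set" where
  "box_domain d a b = (\<Pi>\<^sub>E i\<in>{1..d}. {a i<..<b i})"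

definition time_step :: "real \<Rightarrow> nat \<Rightarrow> real" where
  "time_step Tf M = Tf / real M"

definition half_time :: "real \<Rightarrow> nat \<Rightarrow> nat \<Rightarrow> real" where
  "half_time Tf M m = (real m + 1 / 2) * time_step Tf M"

definition space_step :: "(nat \<Rightarrow> real) \<Rightarrow> (nat \<Rightarrow> real) \<Rightarrow> (nat \<Rightarrow> nat) \<Rightarrow> nat \<Rightarrow> real" where
  "space_step a b n i = (b i - a i) / (real (n i) + 1)"

text \<open>
  Component \<open>i\<close>, between 1 and \<open>n i\<close>, of the multi-index at position \<open>p\<close>, which runs over
  \<open>0, \<dots>, total_size d n - 1\<close>.  These are the mixed-radix digits of \<open>p\<close>, the last one being the
  least significant: the last component varies fastest, in accordance with \<open>kron\<close>.
\<close>

definition multi_index :: "nat \<Rightarrow> (nat \<Rightarrow> nat) \<Rightarrow> nat \<Rightarrow> nat \<Rightarrow> nat" where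
  "multi_index d n p i = (p div size_above d n i) mod n i + 1"

definition grid_point ::
  "nat \<Rightarrow> (nat \<Rightarrow> real) \<Rightarrow> (nat \<Rightarrow> real) \<Rightarrow> (nat \<Rightarrow> nat) \<Rightarrow> nat \<Rightarrow> (nat \<Rightarrow> real)" where
  "grid_point d a b n p =
     (\<lambda>i\<in>{1..d}. a i + real (multi_index d n p i) * space_step a b n i)"

subsection \<open>The system matrix and the preconditioner\<close>

definition eta :: "(nat \<Rightarrow> real) \<Rightarrow> (nat \<Rightarrow> real) \<Rightarrow> (nat \<Rightarrow> real) \<Rightarrow> (nat \<Rightarrow> real) \<Rightarrow>
    (nat \<Rightarrow> nat) \<Rightarrow> real \<Rightarrow> nat \<Rightarrow> nat \<Rightarrow> real" where
  "eta a b \<alpha> K n Tf M i = K i * time_step Tf M / (2 * space_step a b n i powr \<alpha> i)"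

definition D_mat :: "nat \<Rightarrow> (nat \<Rightarrow> real) \<Rightarrow> (nat \<Rightarrow> real) \<Rightarrow> (nat \<Rightarrow> nat) \<Rightarrow>
    ((nat \<Rightarrow> real) \<Rightarrow> real \<Rightarrow> real) \<Rightarrow> real \<Rightarrow> real mat" where
  "D_mat d a b n r t = mat_diag (total_size d n) (\<lambda>p. r (grid_point d a b n p) t)"

definition T_mat :: "nat \<Rightarrow> (nat \<Rightarrow> real) \<Rightarrow> (nat \<Rightarrow> real) \<Rightarrow> (nat \<Rightarrow> real) \<Rightarrow> (nat \<Rightarrow> real) \<Rightarrow>
    (nat \<Rightarrow> nat) \<Rightarrow> real \<Rightarrow> nat \<Rightarrow> real mat" where
  "T_mat d a b \<alpha> K n Tf M =
     directional_sum d n (eta a b \<alpha> K n Tf M) (\<lambda>i. S_mat (n i) (\<alpha> i))"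

definition tau_T :: "nat \<Rightarrow> (nat \<Rightarrow> real) \<Rightarrow> (nat \<Rightarrow> real) \<Rightarrow> (nat \<Rightarrow> real) \<Rightarrow> (nat \<Rightarrow> real) \<Rightarrow>
    (nat \<Rightarrow> nat) \<Rightarrow> real \<Rightarrow> nat \<Rightarrow> real mat" where
  "tau_T d a b \<alpha> K n Tf M =
     directional_sum d n (eta a b \<alpha> K n Tf M) (\<lambda>i. P_alpha (n i) (\<alpha> i))"

definition P_tau :: "nat \<Rightarrow> (nat \<Rightarrow> real) \<Rightarrow> (nat \<Rightarrow> real) \<Rightarrow> (nat \<Rightarrow> real) \<Rightarrow> (nat \<Rightarrow> real) \<Rightarrow>
    (nat \<Rightarrow> nat) \<Rightarrow> real \<Rightarrow> nat \<Rightarrow> real \<Rightarrow> real mat" where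
  "P_tau d a b \<alpha> K n Tf M rbar =
     rbar \<cdot>\<^sub>m 1\<^sub>m (total_size d n) + tau_T d a b \<alpha> K n Tf M"

definition r_hat :: "nat \<Rightarrow> (nat \<Rightarrow> real) \<Rightarrow> (nat \<Rightarrow> real) \<Rightarrow>
    ((nat \<Rightarrow> real) \<Rightarrow> real \<Rightarrow> real) \<Rightarrow> real \<Rightarrow> real" where
  "r_hat d a b r t = (SUP x\<in>box_domain d a b. r x t)"

definition r_check :: "nat \<Rightarrow> (nat \<Rightarrow> real) \<Rightarrow> (nat \<Rightarrow> real) \<Rightarrow>
    ((nat \<Rightarrow> real) \<Rightarrow> real \<Rightarrow> real) \<Rightarrow> real \<Rightarrow> real" where
  "r_check d a b r t = (INF x\<in>box_domain d a b. r x t)"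

text \<open>
  The inverse is unspecified for a singular \<open>P\<close>, so that a bound on the eigenvalues of a
  preconditioned matrix can only be proved along with the invertibility of \<open>P\<close>.
\<close>

definition preconditioned :: "real mat \<Rightarrow> real mat \<Rightarrow> real mat" where
  "preconditioned P A = the (mat_inverse P) * A"

end

theory Submission
  imports Defs
begin

text \<open>
  Everything is expressed through quadratic forms.  The coefficients \<open>s_hat \<alpha> k\<close> are nonpositive
  and increasing for \<open>k \<ge> 1\<close>, and their symmetric partial sums telescope to a nonnegative
  quantity.  Hence, with \<open>A\<close> the Toeplitz matrix of \<open>s_hat \<alpha>\<close> and \<open>B\<close> its natural tau matrix, the
  matrices \<open>A\<close>, \<open>2 A - B\<close> and \<open>3 B - 2 A\<close> are diagonally dominant, which gives
  \<open>B / 2 \<le> A \<le> 3 B / 2\<close>.  The fourth-order correction adds \<open>\<alpha> / 24\<close> times the second difference of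
  the coefficients, both in the Toeplitz and in the tau case.  Summation by parts turns the form of
  the second difference into the original form at differences of \<open>x\<close>, and four times the original
  form minus it into the form at sums of neighbours; so the correction lies between
  \<open>0\<close> and \<open>\<alpha> / 6 < 1 / 3\<close> times the uncorrected form.  Therefore
  \<open>3 / 8 P \<le> S \<le> 2 P\<close> for \<open>S = S_mat n \<alpha>\<close> and \<open>P = P_alpha n \<alpha>\<close>.  These inequalities survive Kronecker products with
  identities and nonnegative combinations, and the eigenvalue bounds follow from the generalised
  Rayleigh quotient.
\<close>

subsection \<open>Quadratic forms\<close>

definition quad :: "nat \<Rightarrow> (nat \<Rightarrow> nat \<Rightarrow> real) \<Rightarrow> (nat \<Rightarrow> real) \<Rightarrow> real" where
  "quad n f x = (\<Sum>p<n. \<Sum>q<n. f p q * x p * x q)"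

lemma quad_cong:
  assumes "\<And>p q. p < n \<Longrightarrow> q < n \<Longrightarrow> f p q = g p q"
  shows "quad n f x = quad n g x"
  unfolding quad_def by (intro sum.cong refl) (simp add: assms)

lemma quad_add: "quad n (\<lambda>p q. f p q + g p q) x = quad n f x + quad n g x"
  by (simp add: quad_def distrib_right sum.distrib)

lemma quad_diff: "quad n (\<lambda>p q. f p q - g p q) x = quad n f x - quad n g x"
  by (simp add: quad_def left_diff_distrib sum_subtractf)

lemma quad_scale: "quad n (\<lambda>p q. c * f p q) x = c * quad n f x"
  by (simp add: quad_def sum_distrib_left mult.assoc)

text \<open>By 2 |u| |v| \<le> u^2 + v^2, each off-diagonal term is at least minus half of
  \<open>\<bar>f p q\<bar>\<close> times the two squares. By symmetry the column halves equal the
  row halves, so each square is charged one full row sum, which the diagonal pays for.\<close>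

lemma quad_diag_dominant:
  assumes sym: "\<And>p q. p < n \<Longrightarrow> q < n \<Longrightarrow> f p q = f q p"
    and dom: "\<And>p. p < n \<Longrightarrow> (\<Sum>q\<in>{..<n} - {p}. \<bar>f p q\<bar>) \<le> f p p"
  shows "0 \<le> quad n f x"
proof -
  define b where "b p q = (if q = p then 0 else \<bar>f p q\<bar>)" for p q
  define e where "e p q = (if q = p then f p p * (x p)\<^sup>2 else 0)" for p q
  have b_sym: "b p q = b q p" if "p < n" "q < n" for p q
    using sym[OF that] by (simp add: b_def)
  have b_row: "(\<Sum>q<n. b p q) \<le> f p p" if "p < n" for p
  proof -
    have "(\<Sum>q<n. b p q) = (\<Sum>q\<in>{..<n} - {p}. b p q)"
      by (rule sum.mono_neutral_right) (auto simp: b_def)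
    also have "\<dots> = (\<Sum>q\<in>{..<n} - {p}. \<bar>f p q\<bar>)"
      by (intro sum.cong) (auto simp: b_def)
    finally show ?thesis using dom[OF that] by simp
  qed
  have entry: "e p q - b p q * (x p)\<^sup>2 / 2 - b p q * (x q)\<^sup>2 / 2 \<le> f p q * x p * x q" for p q
  proof (cases "q = p")
    case True
    then show ?thesis by (simp add: e_def b_def power2_eq_square)
  next
    case False
    have "0 \<le> (\<bar>x p\<bar> - \<bar>x q\<bar>)\<^sup>2" by simp
    then have "2 * (\<bar>x p\<bar> * \<bar>x q\<bar>) \<le> (x p)\<^sup>2 + (x q)\<^sup>2"
      by (simp add: power2_diff mult.assoc)
    then have "\<bar>f p q\<bar> * (2 * (\<bar>x p\<bar> * \<bar>x q\<bar>)) \<le> \<bar>f p q\<bar> * ((x p)\<^sup>2 + (x q)\<^sup>2)"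
      by (rule mult_left_mono) simp
    moreover have "- (\<bar>f p q\<bar> * (\<bar>x p\<bar> * \<bar>x q\<bar>)) \<le> f p q * x p * x q"
      using abs_ge_minus_self[of "f p q * x p * x q"] by (simp add: abs_mult mult.assoc)
    ultimately show ?thesis using False by (simp add: e_def b_def field_simps)
  qed
  \<comment> \<open>The surplus of the diagonal over the row sums is rewritten as a double sum, so
    that \<open>entry\<close> applies termwise.\<close>
  have "0 \<le> (\<Sum>p<n. (f p p - (\<Sum>q<n. b p q)) * (x p)\<^sup>2)"
    by (intro sum_nonneg mult_nonneg_nonneg) (auto simp: b_row)
  also have "\<dots> = (\<Sum>p<n. \<Sum>q<n. e p q) - (\<Sum>p<n. \<Sum>q<n. b p q * (x p)\<^sup>2)"
    by (simp add: e_def left_diff_distrib sum_subtractf sum_distrib_right sum.delta)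
  also have "\<dots> = (\<Sum>p<n. \<Sum>q<n. e p q - b p q * (x p)\<^sup>2 / 2 - b p q * (x q)\<^sup>2 / 2)"
  proof -
    have "(\<Sum>p<n. \<Sum>q<n. b p q * (x q)\<^sup>2) = (\<Sum>q<n. \<Sum>p<n. b p q * (x q)\<^sup>2)"
      by (rule sum.swap)
    also have "\<dots> = (\<Sum>p<n. \<Sum>q<n. b p q * (x p)\<^sup>2)"
      by (intro sum.cong refl) (simp add: b_sym)
    finally show ?thesis
      by (simp add: sum_subtractf flip: sum_divide_distrib)
  qed
  also have "\<dots> \<le> quad n f x"
    unfolding quad_def by (intro sum_mono entry)
  finally show ?thesis .
qed

text \<open>
  Multiplying a symbol by \<open>\<bar>1 - \<sigma> e\<^sup>i\<^sup>\<theta>\<bar>\<^sup>2\<close> amounts to replacing \<open>x\<close> by \<open>y\<close>: the choices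
  \<open>\<sigma> = 1\<close> and \<open>\<sigma> = -1\<close> give the factors \<open>2 - 2 cos \<theta>\<close> and \<open>2 + 2 cos \<theta>\<close>.
\<close>

lemma quad_by_parts:
  fixes x :: "nat \<Rightarrow> real" and \<sigma> :: real
  assumes "\<And>p q. p < n \<Longrightarrow> q < n \<Longrightarrow>
    f p q = g p q - \<sigma> * g (Suc p) q - \<sigma> * g p (Suc q) + \<sigma>\<^sup>2 * g (Suc p) (Suc q)"
    and y: "y = (\<lambda>p. (if p < n then x p else 0) - \<sigma> * (if p = 0 then 0 else x (p - 1)))"
  shows "quad n f x = quad (Suc n) g y"
proof -
  \<comment> \<open>\<open>y\<close> is \<open>x\<close>, extended by zero at both ends, minus
    \<sigma> times its shift. Shifting the index moves the difference from \<open>y\<close> to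
    \<open>h\<close> without boundary terms, at the price of one more index.\<close>
  have parts: "(\<Sum>p<Suc n. y p * h p) = (\<Sum>p<n. x p * (h p - \<sigma> * h (Suc p)))" for h
  proof -
    have "(\<Sum>p<Suc n. (if p < n then x p else 0) * h p) = (\<Sum>p<n. x p * h p)"
      by simp
    moreover have "(\<Sum>p<Suc n. (if p = 0 then 0 else x (p - 1)) * h p) = (\<Sum>p<n. x p * h (Suc p))"
      by (subst sum.lessThan_Suc_shift) simp
    moreover have "(\<Sum>p<Suc n. y p * h p) = (\<Sum>p<Suc n. (if p < n then x p else 0) * h p)
        - \<sigma> * (\<Sum>p<Suc n. (if p = 0 then 0 else x (p - 1)) * h p)"
      unfolding y sum_distrib_left sum_subtractf[symmetric]
      by (intro sum.cong refl) (simp add: algebra_simps)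
    ultimately show ?thesis
      by (simp add: right_diff_distrib sum_subtractf sum_distrib_left mult.left_commute)
  qed
  have "quad (Suc n) g y = (\<Sum>p<Suc n. y p * (\<Sum>q<Suc n. y q * g p q))"
    unfolding quad_def sum_distrib_left by (intro sum.cong refl) (simp add: mult_ac)
  also have "\<dots> = (\<Sum>p<n. x p * ((\<Sum>q<n. x q * (g p q - \<sigma> * g p (Suc q)))
      - \<sigma> * (\<Sum>q<n. x q * (g (Suc p) q - \<sigma> * g (Suc p) (Suc q)))))"
    by (simp only: parts)
  also have "\<dots> = quad n f x"
    unfolding quad_def sum_distrib_left sum_subtractf[symmetric]
    by (intro sum.cong refl) (simp add: assms(1) algebra_simps power2_eq_square)
  finally show ?thesis ..
qed

text \<open>
  Even in \<open>l\<close> and symmetric about \<open>n + 1\<close>, so that with 1-based indices the entries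
  \<open>g (j - k) - g (j + k)\<close> of the natural tau matrix vanish for \<open>j = 0\<close> and for \<open>j = n + 1\<close>.
\<close>

definition fold_coeff :: "nat \<Rightarrow> (int \<Rightarrow> real) \<Rightarrow> int \<Rightarrow> real" where
  "fold_coeff n a l = (if \<bar>l\<bar> < int n then a \<bar>l\<bar>
     else if \<bar>l\<bar> \<ge> int n + 3 then a (2 * int n + 2 - \<bar>l\<bar>) else 0)"

text \<open>These are the Fourier coefficients after multiplying the symbol of \<open>a\<close> by 2
  - 2 cos \<theta>.\<close>

definition second_diff :: "(int \<Rightarrow> real) \<Rightarrow> int \<Rightarrow> real" where
  "second_diff a l = 2 * a l - a (l - 1) - a (l + 1)"

text \<open>The \<open>+ 2\<close> translates the sum of two 1-based indices to 0-based
  \<open>p\<close> and \<open>q\<close>.\<close>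

definition tau_kernel :: "(int \<Rightarrow> real) \<Rightarrow> nat \<Rightarrow> nat \<Rightarrow> real" where
  "tau_kernel g p q = g (int p - int q) - g (int p + int q + 2)"

lemma fold_coeff_minus: "fold_coeff n a (- l) = fold_coeff n a l"
  by (simp add: fold_coeff_def)

lemma fold_coeff_reflect:
  "0 \<le> l \<Longrightarrow> l \<le> 2 * int n + 2 \<Longrightarrow> fold_coeff n a (2 * int n + 2 - l) = fold_coeff n a l"
  by (auto simp: fold_coeff_def)

subsection \<open>Spectral equivalence of a Toeplitz matrix and its tau matrix\<close>

text \<open>The properties of \<open>s_hat\<close> on which diagonal dominance rests:
  \<open>nonpos\<close> and \<open>partial_sum\<close> bound off-diagonal row sums by
  \<open>a 0\<close>, and \<open>incr\<close> compares Toeplitz entries with Hankel entries.\<close>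

locale laplacian_coeffs =
  fixes a :: "int \<Rightarrow> real"
  assumes even: "a (- k) = a k"
    and nonpos: "1 \<le> k \<Longrightarrow> a k \<le> 0"
    and incr: "1 \<le> k \<Longrightarrow> a k \<le> a (k + 1)"
    and partial_sum: "0 \<le> a 0 + 2 * (\<Sum>k=1..N. a (int k))"
begin

lemma abs_arg: "a \<bar>k\<bar> = a k"
  by (simp add: abs_if even)

lemma mono_coeff:
  assumes "1 \<le> k" "k \<le> l"
  shows "a k \<le> a l"
  using assms(2)
proof (induction l rule: int_ge_induct)
  case base
  show ?case by simp
next
  case (step l)
  then show ?case using incr[of l] assms(1) by linarith
qed

lemma fold_coeff_inside: "\<bar>l\<bar> < int n \<Longrightarrow> fold_coeff n a l = a l"
  by (simp add: fold_coeff_def abs_arg)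

lemma fold_coeff_nonpos: "1 \<le> l \<Longrightarrow> l \<le> 2 * int n + 1 \<Longrightarrow> fold_coeff n a l \<le> 0"
  by (simp add: fold_coeff_def nonpos)

section \<open>Row sums of the Toeplitz and Hankel parts together\<close>

text \<open>The indices tile two intervals. The first sum covers 1..j and 1..n-j; the second covers
  j+1..n+1, which completes 1..j, and n+2..j+n+1, which reflects onto n-j+1..n and completes 1..n-j.
  The total is twice the sum of |a l| for 1 \<le> l \<le> n-1, controlled by
  \<open>partial_sum\<close>.\<close>

lemma fold_coeff_row_sum:
  assumes "j \<le> n" "n > 0"
  shows "(\<Sum>k\<in>{..n} - {j}. \<bar>fold_coeff n a (int j - int k)\<bar>)
      + (\<Sum>k\<le>n. \<bar>fold_coeff n a (int j + int k + 1)\<bar>) \<le> a 0"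
proof -
  define F where "F l = \<bar>fold_coeff n a (int l)\<bar>" for l
  have "(\<Sum>k\<in>{..n} - {j}. \<bar>fold_coeff n a (int j - int k)\<bar>) =
     (\<Sum>k<j. F (j - k)) + (\<Sum>k\<in>{j<..n}. F (k - j))"
  proof -
    have "{..n} - {j} = {..<j} \<union> {j<..n}" using assms by auto
    moreover have "(\<Sum>k<j. \<bar>fold_coeff n a (int j - int k)\<bar>) = (\<Sum>k<j. F (j - k))"
      by (intro sum.cong refl) (simp add: F_def of_nat_diff)
    moreover have "(\<Sum>k\<in>{j<..n}. \<bar>fold_coeff n a (int j - int k)\<bar>) = (\<Sum>k\<in>{j<..n}. F (k - j))"
    proof (intro sum.cong refl)
      fix k assume "k \<in> {j<..n}"
      then have "int j - int k = - int (k - j)" by auto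
      then show "\<bar>fold_coeff n a (int j - int k)\<bar> = F (k - j)"
        by (simp only: F_def fold_coeff_minus)
    qed
    moreover have "sum h ({..<j} \<union> {j<..n}) = sum h {..<j} + sum h {j<..n}" for h :: "nat \<Rightarrow> real"
      by (rule sum.union_disjoint) auto
    ultimately show ?thesis by simp
  qed
  moreover have "(\<Sum>k<j. F (j - k)) = sum F {1..j}"
    by (rule sum.reindex_bij_witness[of _ "\<lambda>l. j - l" "\<lambda>k. j - k"]) auto
  moreover have "(\<Sum>k\<in>{j<..n}. F (k - j)) = sum F {1..n - j}"
    by (rule sum.reindex_bij_witness[of _ "\<lambda>l. l + j" "\<lambda>k. k - j"]) auto
  moreover have "(\<Sum>k\<le>n. \<bar>fold_coeff n a (int j + int k + 1)\<bar>) = sum F {j + 1..j + n + 1}"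
    by (rule sum.reindex_bij_witness[of _ "\<lambda>l. l - j - 1" "\<lambda>k. j + k + 1"])
      (auto simp: F_def of_nat_diff algebra_simps)
  moreover have "sum F {j + 1..j + n + 1} = sum F {j + 1..n + 1} + sum F {n + 2..j + n + 1}"
  proof -
    have "{j + 1..j + n + 1} = {j + 1..n + 1} \<union> {n + 2..j + n + 1}" using assms by auto
    then show ?thesis by (simp add: sum.union_disjoint)
  qed
  moreover have "sum F {n + 2..j + n + 1} = sum F {n - j + 1..n}"
  proof (rule sum.reindex_bij_witness[of _ "\<lambda>l. 2 * n + 2 - l" "\<lambda>l. 2 * n + 2 - l"])
    fix l assume l: "l \<in> {n + 2..j + n + 1}"
    then have "int (2 * n + 2 - l) = 2 * int n + 2 - int l" using assms by auto
    moreover have "fold_coeff n a (2 * int n + 2 - int l) = fold_coeff n a (int l)"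
      by (rule fold_coeff_reflect) (use l assms in auto)
    ultimately show "F (2 * n + 2 - l) = F l"
      by (simp only: F_def)
  qed (use assms in auto)
  moreover have "sum F {1..j} + sum F {j + 1..n + 1} = sum F {1..n + 1}"
  proof -
    have "{1..n + 1} = {1..j} \<union> {j + 1..n + 1}" using assms by auto
    then show ?thesis by (simp add: sum.union_disjoint)
  qed
  moreover have "sum F {1..n - j} + sum F {n - j + 1..n} = sum F {1..n}"
  proof -
    have "{1..n} = {1..n - j} \<union> {n - j + 1..n}" using assms by auto
    then show ?thesis by (simp add: sum.union_disjoint)
  qed
  \<comment> \<open>The folded coefficients vanish at n and n+1, so both intervals give the same
    sum.\<close>
  moreover have "sum F {1..m} = - (\<Sum>l=1..n - 1. a (int l))" if "n - 1 \<le> m" "m \<le> n + 1" for m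
  proof -
    have "sum F {1..m} = sum F {1..n - 1}"
      by (rule sum.mono_neutral_right) (use that in \<open>auto simp: F_def fold_coeff_def\<close>)
    also have "\<dots> = (\<Sum>l=1..n - 1. - a (int l))"
      by (intro sum.cong refl) (use nonpos in \<open>auto simp: F_def fold_coeff_def\<close>)
    finally show ?thesis by (simp add: sum_negf)
  qed
  from this[of n] this[of "n + 1"] have "sum F {1..n} = - (\<Sum>l=1..n - 1. a (int l))"
    "sum F {1..n + 1} = - (\<Sum>l=1..n - 1. a (int l))" by auto
  ultimately show ?thesis using partial_sum[of "n - 1"] by linarith
qed

text \<open>This is row \<open>p + 1\<close> of the preceding bound, without column 0 in the first
  sum and without column n in the second.\<close>

lemma toeplitz_row_sum:
  assumes "p < n"
  shows "(\<Sum>q\<in>{..<n} - {p}. \<bar>a (int p - int q)\<bar>)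
      + (\<Sum>q\<in>{..<n}. \<bar>fold_coeff n a (int p + int q + 2)\<bar>) \<le> a 0"
proof -
  have "(\<Sum>q\<in>{..<n} - {p}. \<bar>a (int p - int q)\<bar>) = (\<Sum>k\<in>{1..n} - {p + 1}. \<bar>fold_coeff n a (int (p + 1) - int k)\<bar>)"
    by (rule sum.reindex_bij_witness[of _ "\<lambda>k. k - 1" "\<lambda>q. q + 1"])
      (use assms in \<open>auto simp: fold_coeff_inside\<close>)
  also have "\<dots> \<le> (\<Sum>k\<in>{..n} - {p + 1}. \<bar>fold_coeff n a (int (p + 1) - int k)\<bar>)"
    by (intro sum_mono2) auto
  finally have 1: "(\<Sum>q\<in>{..<n} - {p}. \<bar>a (int p - int q)\<bar>) \<le> \<dots>" .
  have "(\<Sum>q\<in>{..<n}. \<bar>fold_coeff n a (int p + int q + 2)\<bar>) = (\<Sum>q\<in>{..<n}. \<bar>fold_coeff n a (int (p + 1) + int q + 1)\<bar>)"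
    by (intro sum.cong refl) (simp add: algebra_simps)
  also have "\<dots> \<le> (\<Sum>q\<le>n. \<bar>fold_coeff n a (int (p + 1) + int q + 1)\<bar>)"
    by (intro sum_mono2) auto
  finally show ?thesis using 1 fold_coeff_row_sum[of "p + 1" n] assms by linarith
qed

text \<open>Common criterion for the three matrices compared below. The row bound also counts the
  Hankel term of column p itself, which becomes the slack allowed on the diagonal.\<close>

lemma quad_dominated:
  assumes "\<And>p q. p < n \<Longrightarrow> q < n \<Longrightarrow> f p q = f q p"
    and "\<And>p. p < n \<Longrightarrow> a 0 - \<bar>fold_coeff n a (2 * int p + 2)\<bar> \<le> f p p"
    and "\<And>p q. p < n \<Longrightarrow> q < n \<Longrightarrow> p \<noteq> q \<Longrightarrow>
      \<bar>f p q\<bar> \<le> \<bar>a (int p - int q)\<bar> + \<bar>fold_coeff n a (int p + int q + 2)\<bar>"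
  shows "0 \<le> quad n f x"
proof (rule quad_diag_dominant)
  fix p assume p: "p < n"
  have "(\<Sum>q\<in>{..<n} - {p}. \<bar>f p q\<bar>) \<le> (\<Sum>q\<in>{..<n} - {p}. \<bar>a (int p - int q)\<bar> + \<bar>fold_coeff n a (int p + int q + 2)\<bar>)"
    by (intro sum_mono assms(3)) (use p in auto)
  also have "\<dots> = (\<Sum>q\<in>{..<n} - {p}. \<bar>a (int p - int q)\<bar>)
      + ((\<Sum>q\<in>{..<n}. \<bar>fold_coeff n a (int p + int q + 2)\<bar>) - \<bar>fold_coeff n a (2 * int p + 2)\<bar>)"
    using p by (simp add: sum.distrib sum_diff1)
  also have "\<dots> \<le> f p p"
    using toeplitz_row_sum[OF p] assms(2)[OF p] by linarith
  finally show "(\<Sum>q\<in>{..<n} - {p}. \<bar>f p q\<bar>) \<le> f p p" .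
qed (rule assms(1))

section \<open>Comparison of the uncorrected Toeplitz and tau forms\<close>

lemma toeplitz_nonneg: "0 \<le> quad n (\<lambda>p q. a (int p - int q)) x"
proof (rule quad_dominated)
  fix p q show "a (int p - int q) = a (int q - int p)"
    using even[of "int p - int q"] by simp
qed auto

lemma tau_kernel_fold_coeff_sym: "tau_kernel (fold_coeff n a) p q = tau_kernel (fold_coeff n a) q p"
  using fold_coeff_minus[of n a "int p - int q"] by (simp add: tau_kernel_def add.commute)

lemma tau_kernel_fold_coeff:
  "p < n \<Longrightarrow> q < n \<Longrightarrow>
    tau_kernel (fold_coeff n a) p q = a (int p - int q) - fold_coeff n a (int p + int q + 2)"
  by (auto simp: tau_kernel_def fold_coeff_inside)

text \<open>Writing the tau matrix as B = A - H with Hankel part H, 2 A - B = A + H is dominated by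
  the triangle inequality.\<close>

lemma tau_le_toeplitz:
  "quad n (tau_kernel (fold_coeff n a)) x \<le> 2 * quad n (\<lambda>p q. a (int p - int q)) x"
proof -
  have "0 \<le> quad n (\<lambda>p q. 2 * a (int p - int q) - tau_kernel (fold_coeff n a) p q) x"
  proof (rule quad_dominated)
    fix p q show "2 * a (int p - int q) - tau_kernel (fold_coeff n a) p q
        = 2 * a (int q - int p) - tau_kernel (fold_coeff n a) q p"
      using even[of "int p - int q"] by (simp add: tau_kernel_fold_coeff_sym[of n p q])
  qed (auto simp: tau_kernel_fold_coeff)
  then show ?thesis by (simp add: quad_diff quad_scale)
qed

text \<open>Where the Hankel entry is not zero, its index is p+q+2 or 2n-p-q, and both are at least
  |p-q|; monotonicity of the coefficients then applies.\<close>

lemma toeplitz_le_fold_coeff: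
  assumes "p < n" "q < n" "p \<noteq> q"
  shows "a (int p - int q) \<le> fold_coeff n a (int p + int q + 2)"
proof -
  have "a \<bar>int p - int q\<bar> \<le> fold_coeff n a (int p + int q + 2)"
    using assms nonpos[of "\<bar>int p - int q\<bar>"]
    by (auto simp: fold_coeff_def intro!: mono_coeff)
  then show ?thesis by (simp only: abs_arg)
qed

text \<open>Here 3 B - 2 A = A - 3 H. Entries a \<le> h \<le> 0 satisfy |a - 3h| \<le> |a| + |h|,
  with equality at a = h, which is where the factor 3 comes from.\<close>

lemma toeplitz_le_tau:
  "2 * quad n (\<lambda>p q. a (int p - int q)) x \<le> 3 * quad n (tau_kernel (fold_coeff n a)) x"
proof -
  have "0 \<le> quad n (\<lambda>p q. 3 * tau_kernel (fold_coeff n a) p q - 2 * a (int p - int q)) x"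
  proof (rule quad_dominated)
    fix p q show "3 * tau_kernel (fold_coeff n a) p q - 2 * a (int p - int q)
        = 3 * tau_kernel (fold_coeff n a) q p - 2 * a (int q - int p)"
      using even[of "int p - int q"] by (simp add: tau_kernel_fold_coeff_sym[of n p q])
  next
    fix p assume "p < n"
    then show "a 0 - \<bar>fold_coeff n a (2 * int p + 2)\<bar>
        \<le> 3 * tau_kernel (fold_coeff n a) p p - 2 * a (int p - int p)"
      using fold_coeff_nonpos[of "2 * int p + 2" n] by (simp add: tau_kernel_fold_coeff)
  next
    fix p q assume pq: "p < n" "q < n" "p \<noteq> q"
    show "\<bar>3 * tau_kernel (fold_coeff n a) p q - 2 * a (int p - int q)\<bar>
        \<le> \<bar>a (int p - int q)\<bar> + \<bar>fold_coeff n a (int p + int q + 2)\<bar>"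
      using toeplitz_le_fold_coeff[OF pq] fold_coeff_nonpos[of "int p + int q + 2" n] pq
      by (simp add: tau_kernel_fold_coeff)
  qed
  then show ?thesis by (simp add: quad_diff quad_scale)
qed

text \<open>
  These are the kernels that summation by parts produces from the tau matrices of
  \<open>2 g l - g (l - 1) - g (l + 1)\<close> and of \<open>2 g l + g (l - 1) + g (l + 1)\<close>.
\<close>

lemma quad_fold_coeff_nonneg:
  assumes "n > 0" "\<bar>\<sigma>\<bar> = 1"
  shows "0 \<le> quad (Suc n) (\<lambda>p q. fold_coeff n a (int p - int q) + \<sigma> * fold_coeff n a (int p + int q + 1)) x"
proof (rule quad_diag_dominant)
  fix p q
  show "fold_coeff n a (int p - int q) + \<sigma> * fold_coeff n a (int p + int q + 1)
      = fold_coeff n a (int q - int p) + \<sigma> * fold_coeff n a (int q + int p + 1)"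
    using fold_coeff_minus[of n a "int p - int q"] by (simp add: add.commute)
next
  fix p assume p: "p < Suc n"
  let ?g = "fold_coeff n a"
  have abs_le: "\<bar>u + \<sigma> * v\<bar> \<le> \<bar>u\<bar> + \<bar>v\<bar>" for u v
    using abs_triangle_ineq[of u "\<sigma> * v"] assms(2) by (simp add: abs_mult)
  have "(\<Sum>q\<in>{..<Suc n} - {p}. \<bar>?g (int p - int q) + \<sigma> * ?g (int p + int q + 1)\<bar>)
     \<le> (\<Sum>q\<in>{..n} - {p}. \<bar>?g (int p - int q)\<bar> + \<bar>?g (int p + int q + 1)\<bar>)"
    unfolding lessThan_Suc_atMost by (intro sum_mono abs_le)
  also have "\<dots> = (\<Sum>q\<in>{..n} - {p}. \<bar>?g (int p - int q)\<bar>)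
      + ((\<Sum>q\<le>n. \<bar>?g (int p + int q + 1)\<bar>) - \<bar>?g (int p + int p + 1)\<bar>)"
    using p by (simp add: sum.distrib sum_diff1)
  \<comment> \<open>The row bound includes column p in its Hankel sum; this term makes room for the
    \<sigma>-term on the diagonal.\<close>
  also have "\<dots> \<le> a 0 - \<bar>?g (int p + int p + 1)\<bar>"
    using fold_coeff_row_sum[of p n] p assms(1) by simp
  also have "\<dots> \<le> ?g (int p - int p) + \<sigma> * ?g (int p + int p + 1)"
    using abs_ge_minus_self[of "\<sigma> * ?g (int p + int p + 1)"] assms
    by (simp add: abs_mult fold_coeff_def)
  finally show "(\<Sum>q\<in>{..<Suc n} - {p}. \<bar>?g (int p - int q) + \<sigma> * ?g (int p + int q + 1)\<bar>)
     \<le> ?g (int p - int p) + \<sigma> * ?g (int p + int p + 1)" .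
qed

section \<open>Bounds for the fourth-order correction\<close>

lemma toeplitz_second_diff_nonneg: "0 \<le> quad n (\<lambda>p q. second_diff a (int p - int q)) x"
proof -
  have "quad n (\<lambda>p q. second_diff a (int p - int q)) x
     = quad (Suc n) (\<lambda>p q. a (int p - int q)) (\<lambda>p. (if p < n then x p else 0) - 1 * (if p = 0 then 0 else x (p - 1)))"
    by (rule quad_by_parts[where \<sigma> = "1"]) (auto simp: second_diff_def algebra_simps)
  then show ?thesis using toeplitz_nonneg by simp
qed

text \<open>Since 4 - (2 - 2 cos \<theta>) = 2 + 2 cos \<theta>, the difference is the case \<sigma>
  = -1 of summation by parts.\<close>

lemma toeplitz_second_diff_le:
  "quad n (\<lambda>p q. second_diff a (int p - int q)) x \<le> 4 * quad n (\<lambda>p q. a (int p - int q)) x"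
proof -
  have "quad n (\<lambda>p q. 4 * a (int p - int q) - second_diff a (int p - int q)) x
     = quad (Suc n) (\<lambda>p q. a (int p - int q)) (\<lambda>p. (if p < n then x p else 0) - (- 1) * (if p = 0 then 0 else x (p - 1)))"
    by (rule quad_by_parts[where \<sigma> = "- 1"]) (auto simp: second_diff_def algebra_simps)
  then have "0 \<le> quad n (\<lambda>p q. 4 * a (int p - int q) - second_diff a (int p - int q)) x"
    using toeplitz_nonneg by simp
  then show ?thesis by (simp add: quad_diff quad_scale)
qed

text \<open>In the kernel with Hankel index p+q+1, the four neighbours have indices p+q+1, twice
  p+q+2, and p+q+3. They combine to minus the second difference at p+q+2, as in the tau
  kernel.\<close>

lemma tau_second_diff_nonneg:
  assumes "n > 0"
  shows "0 \<le> quad n (tau_kernel (second_diff (fold_coeff n a))) x"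
proof -
  have "quad n (tau_kernel (second_diff (fold_coeff n a))) x
     = quad (Suc n) (\<lambda>p q. fold_coeff n a (int p - int q) + 1 * fold_coeff n a (int p + int q + 1))
         (\<lambda>p. (if p < n then x p else 0) - 1 * (if p = 0 then 0 else x (p - 1)))"
    by (rule quad_by_parts[where \<sigma> = "1"]) (auto simp: tau_kernel_def second_diff_def algebra_simps)
  then show ?thesis using quad_fold_coeff_nonneg[of n 1, OF assms] by simp
qed

lemma tau_second_diff_le:
  assumes "n > 0"
  shows "quad n (tau_kernel (second_diff (fold_coeff n a))) x \<le> 4 * quad n (tau_kernel (fold_coeff n a)) x"
proof -
  have "quad n (\<lambda>p q. 4 * tau_kernel (fold_coeff n a) p q - tau_kernel (second_diff (fold_coeff n a)) p q) x
     = quad (Suc n) (\<lambda>p q. fold_coeff n a (int p - int q) + (- 1) * fold_coeff n a (int p + int q + 1))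
         (\<lambda>p. (if p < n then x p else 0) - (- 1) * (if p = 0 then 0 else x (p - 1)))"
    by (rule quad_by_parts[where \<sigma> = "- 1"]) (auto simp: tau_kernel_def second_diff_def algebra_simps)
  then have "0 \<le> quad n (\<lambda>p q. 4 * tau_kernel (fold_coeff n a) p q - tau_kernel (second_diff (fold_coeff n a)) p q) x"
    using quad_fold_coeff_nonneg[of n "- 1", OF assms] by simp
  then show ?thesis by (simp add: quad_diff quad_scale)
qed

lemma spectral_equivalence:
  assumes "n > 0" "0 \<le> \<kappa>" "\<kappa> \<le> 1 / 12"
  defines "qS \<equiv> quad n (\<lambda>p q. a (int p - int q) + \<kappa> * second_diff a (int p - int q))"
    and "qP \<equiv> quad n (\<lambda>p q. tau_kernel (fold_coeff n a) p q + \<kappa> * tau_kernel (second_diff (fold_coeff n a)) p q)"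
  shows "0 \<le> qP x" "3 / 8 * qP x \<le> qS x" "qS x \<le> 2 * qP x"
proof -
  let ?A = "quad n (\<lambda>p q. a (int p - int q)) x"
  let ?A2 = "quad n (\<lambda>p q. second_diff a (int p - int q)) x"
  let ?B = "quad n (tau_kernel (fold_coeff n a)) x"
  let ?B2 = "quad n (tau_kernel (second_diff (fold_coeff n a))) x"
  define u v where "u = \<kappa> * ?A2" and "v = \<kappa> * ?B2"
  have S: "qS x = ?A + u" and P: "qP x = ?B + v"
    by (simp_all add: qS_def qP_def u_def v_def quad_add quad_scale)
  have A: "0 \<le> ?A" "0 \<le> ?A2" "?A2 \<le> 4 * ?A"
    by (rule toeplitz_nonneg toeplitz_second_diff_nonneg toeplitz_second_diff_le)+
  have B: "0 \<le> ?B2" "?B2 \<le> 4 * ?B"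
    by (rule tau_second_diff_nonneg[OF assms(1)] tau_second_diff_le[OF assms(1)])+
  have AB: "?B \<le> 2 * ?A" "2 * ?A \<le> 3 * ?B"
    by (rule tau_le_toeplitz toeplitz_le_tau)+
  have "0 \<le> u" "0 \<le> v"
    using A(2) B(1) assms(2) by (auto simp: u_def v_def)
  moreover have "u \<le> 1 / 12 * (4 * ?A)" "v \<le> 1 / 12 * (4 * ?B)"
    unfolding u_def v_def by (intro mult_mono; use A B assms(2,3) in simp)+
  then have "3 * u \<le> ?A" "3 * v \<le> ?B" by simp_all
  \<comment> \<open>Now A \<le> S \<le> 4/3 A and B \<le> P \<le> 4/3 B, so S \<ge> A \<ge> B/2
    \<ge> 3/8 P and S \<le> 4/3 A \<le> 2 B \<le> 2 P. Nonnegativity of B follows from 0 \<le>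
    \<open>?B2\<close> \<le> 4 \<open>?B\<close>.\<close>
  ultimately show "0 \<le> qP x" "3 / 8 * qP x \<le> qS x" "qS x \<le> 2 * qP x"
    using A(1) B AB unfolding S P by (simp_all add: field_simps)
qed

end

subsection \<open>The coefficients of the fractional Laplacian\<close>

text \<open>The reciprocal Gamma function satisfies its recurrence at the poles of \<open>Gamma\<close> as well.\<close>

lemma s_hat_altdef:
  "s_hat \<alpha> k = ((-1) powi k) * Gamma (\<alpha> + 1) * (rGamma (\<alpha> / 2 - of_int k + 1) * rGamma (\<alpha> / 2 + of_int k + 1))"
  unfolding s_hat_def rGamma_inverse_Gamma divide_inverse inverse_mult_distrib ..

lemma s_hat_minus: "s_hat \<alpha> (- k) = s_hat \<alpha> k"
  by (simp add: s_hat_def power_int_minus_one_minus mult.commute)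

text \<open>Raising k raises one Gamma argument and lowers the other, so the recurrence is used once
  in each direction. Signs, monotonicity, partial sums and second differences all follow from this
  ratio.\<close>

lemma s_hat_step: "(\<alpha> / 2 + of_int k + 1) * s_hat \<alpha> (k + 1) = (of_int k - \<alpha> / 2) * s_hat \<alpha> k"
proof -
  have 1: "(\<alpha> / 2 + of_int k + 1) * rGamma (\<alpha> / 2 + of_int (k + 1) + 1) = rGamma (\<alpha> / 2 + of_int k + 1)"
    using rGamma_plus1[of "\<alpha> / 2 + of_int k + 1"] by (simp add: add_ac)
  have 2: "rGamma (\<alpha> / 2 - of_int (k + 1) + 1) = (\<alpha> / 2 - of_int k) * rGamma (\<alpha> / 2 - of_int k + 1)"
    using rGamma_plus1[of "\<alpha> / 2 - of_int k"] by simp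
  have "(\<alpha> / 2 + of_int k + 1) * s_hat \<alpha> (k + 1) = - ((-1) powi k) * Gamma (\<alpha> + 1) *
    (rGamma (\<alpha> / 2 - of_int (k + 1) + 1) * ((\<alpha> / 2 + of_int k + 1) * rGamma (\<alpha> / 2 + of_int (k + 1) + 1)))"
    by (simp only: s_hat_altdef) (simp add: power_int_add)
  also have "\<dots> = (of_int k - \<alpha> / 2) * s_hat \<alpha> k"
    unfolding 1 2 s_hat_altdef by (simp add: algebra_simps)
  finally show ?thesis .
qed

lemma s_hat_0_pos: "0 < \<alpha> \<Longrightarrow> 0 < s_hat \<alpha> 0"
  by (simp add: s_hat_def)

text \<open>The factor k - \<alpha>/2 is negative at k = 0 and positive from k = 1 on, so the sign
  changes exactly once, after the positive \<open>s_hat \<alpha> 0\<close>.\<close>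

lemma s_hat_nonpos:
  assumes "0 < \<alpha>" "\<alpha> < 2" "1 \<le> k"
  shows "s_hat \<alpha> k \<le> 0"
  using assms(3)
proof (induction k rule: int_ge_induct)
  case base
  have "(\<alpha> / 2 + 1) * s_hat \<alpha> 1 = - (\<alpha> / 2) * s_hat \<alpha> 0"
    using s_hat_step[of \<alpha> 0] by simp
  also have "\<dots> \<le> 0" using s_hat_0_pos[of \<alpha>] assms by simp
  finally show ?case using assms by (simp add: mult_le_0_iff)
next
  case (step k)
  have "(\<alpha> / 2 + of_int k + 1) * s_hat \<alpha> (k + 1) \<le> 0"
    unfolding s_hat_step by (rule mult_nonneg_nonpos) (use step assms in auto)
  moreover have "0 < \<alpha> / 2 + of_int k + 1" using step assms by simp
  ultimately show ?case by (simp add: mult_le_0_iff)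
qed

lemma s_hat_incr:
  assumes "0 < \<alpha>" "\<alpha> < 2" "1 \<le> k"
  shows "s_hat \<alpha> k \<le> s_hat \<alpha> (k + 1)"
proof -
  have pos: "0 < \<alpha> / 2 + of_int k + 1" using assms by simp
  have "(\<alpha> / 2 + of_int k + 1) * s_hat \<alpha> k \<le> (of_int k - \<alpha> / 2) * s_hat \<alpha> k"
    by (rule mult_right_mono_neg) (use assms s_hat_nonpos in auto)
  then show ?thesis using pos by (simp flip: s_hat_step)
qed

text \<open>The closed form telescopes: its induction step is twice the recurrence. For N \<ge> 1
  and \<alpha> < 2 both factors on the right are nonpositive, which yields
  \<open>partial_sum\<close>.\<close>

lemma s_hat_partial_sum:
  assumes "\<alpha> > 0"
  shows "\<alpha> * (s_hat \<alpha> 0 + 2 * (\<Sum>k=1..N. s_hat \<alpha> (int k))) = (\<alpha> - 2 * real N) * s_hat \<alpha> (int N)"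
proof (induction N)
  case (Suc N)
  have "\<alpha> * (s_hat \<alpha> 0 + 2 * (\<Sum>k=1..Suc N. s_hat \<alpha> (int k)))
     = \<alpha> * (s_hat \<alpha> 0 + 2 * (\<Sum>k=1..N. s_hat \<alpha> (int k))) + 2 * \<alpha> * s_hat \<alpha> (int N + 1)"
    by (simp add: algebra_simps)
  also have "\<dots> = (\<alpha> - 2 * real N) * s_hat \<alpha> (int N) + 2 * \<alpha> * s_hat \<alpha> (int N + 1)"
    by (simp only: Suc.IH)
  also have "\<dots> = (\<alpha> - 2 * real (Suc N)) * s_hat \<alpha> (int (Suc N))"
    using s_hat_step[of \<alpha> "int N"] by (simp add: algebra_simps)
  finally show ?case .
qed simp

lemma laplacian_coeffs_s_hat:
  assumes "0 < \<alpha>" "\<alpha> < 2"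
  shows "laplacian_coeffs (s_hat \<alpha>)"
proof
  fix N :: nat
  have "0 \<le> (\<alpha> - 2 * real N) * s_hat \<alpha> (int N)"
  proof (cases N)
    case 0
    then show ?thesis using s_hat_0_pos[of \<alpha>] assms by simp
  next
    case (Suc k)
    then show ?thesis using s_hat_nonpos[of \<alpha> "int N"] assms by (intro mult_nonpos_nonpos) auto
  qed
  then have "0 \<le> \<alpha> * (s_hat \<alpha> 0 + 2 * (\<Sum>k=1..N. s_hat \<alpha> (int k)))"
    by (simp only: s_hat_partial_sum[OF assms(1)])
  then show "0 \<le> s_hat \<alpha> 0 + 2 * (\<Sum>k=1..N. s_hat \<alpha> (int k))"
    using assms(1) by (simp only: zero_le_mult_iff) linarith
qed (use assms s_hat_minus s_hat_nonpos s_hat_incr in auto)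

section \<open>Fourth-order coefficients and entries of the one-dimensional matrices\<close>

text \<open>The recurrence expresses both neighbours through \<open>s_hat \<alpha> k\<close>,
  turning the second difference into the rational multiple that stands in the bracket of
  \<open>s_coeff\<close>.\<close>

lemma s_coeff_altdef:
  assumes "1 < \<alpha>" "\<alpha> < 2"
  shows "s_coeff \<alpha> k = s_hat \<alpha> k + \<alpha> / 24 * second_diff (s_hat \<alpha>) k"
proof -
  \<comment> \<open>No integer lies strictly between 1 and 2, so the denominators do not
    vanish.\<close>
  have nz: "\<alpha> + 2 * of_int k + 2 \<noteq> 0" for k :: int
  proof
    assume "\<alpha> + 2 * of_int k + 2 = 0"
    then have "\<alpha> = of_int (- 2 * k - 2)" by simp
    then obtain j :: int where "\<alpha> = of_int j" ..
    then show False using assms by simp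
  qed
  let ?u = "\<alpha> + 2 * of_int k + 2" and ?v = "\<alpha> - 2 * of_int k + 2"
  have nz': "?u \<noteq> 0" "?v \<noteq> 0" using nz[of k] nz[of "- k"] by auto
  have up: "s_hat \<alpha> (k + 1) * ?u = (2 * of_int k - \<alpha>) * s_hat \<alpha> k"
    using s_hat_step[of \<alpha> k] by (simp add: field_simps)
  \<comment> \<open>The recurrence at -k, read through evenness, reaches the lower
    neighbour.\<close>
  have down: "s_hat \<alpha> (k - 1) * ?v = (- 2 * of_int k - \<alpha>) * s_hat \<alpha> k"
    using s_hat_step[of \<alpha> "- k"] s_hat_minus[of \<alpha> "k - 1"]
    by (simp add: s_hat_minus field_simps)
  have expand: "(2 * x - y - z) * (u * v) = 2 * x * (u * v) - (y * v) * u - (z * u) * v"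
    for x y z u v :: real
    by (simp add: algebra_simps)
  have "second_diff (s_hat \<alpha>) k * (?u * ?v) = s_hat \<alpha> k * (4 * (\<alpha> + 1) * (\<alpha> + 2))"
    unfolding second_diff_def expand up down by (simp add: algebra_simps)
  with no_zero_divisors[OF nz'] have
    diff: "second_diff (s_hat \<alpha>) k = s_hat \<alpha> k * (4 * (\<alpha> + 1) * (\<alpha> + 2)) / (?u * ?v)"
    by (rule eq_divide_imp)
  have "x * (1 + \<alpha> * y * z / (6 * v * u)) = x + \<alpha> / 24 * (x * (4 * y * z) / (u * v))"
    for x y z u v :: real
  proof -
    have "\<alpha> / 24 * (x * (4 * y * z) / (u * v)) = 4 * (x * \<alpha> * y * z) / (4 * (6 * v * u))"
      by (simp add: mult_ac)
    also have "\<dots> = x * (\<alpha> * y * z / (6 * v * u))"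
      by (subst mult_divide_mult_cancel_left) (simp_all add: mult.assoc)
    finally show ?thesis by (simp only: distrib_left mult_1_right)
  qed
  then show ?thesis by (simp only: s_coeff_def diff)
qed

lemma S_mat_index:
  assumes "1 < \<alpha>" "\<alpha> < 2" "p < n" "q < n"
  shows "S_mat n \<alpha> $$ (p, q) = s_hat \<alpha> (int p - int q) + \<alpha> / 24 * second_diff (s_hat \<alpha>) (int p - int q)"
  using assms by (simp add: S_mat_def toeplitz_def s_coeff_altdef)

lemma natural_tau_index:
  assumes "0 < \<alpha>" "\<alpha> < 2" "p < n" "q < n"
  shows "natural_tau (S_hat_mat n \<alpha>) $$ (p, q) = tau_kernel (fold_coeff n (s_hat \<alpha>)) p q"
proof -
  interpret laplacian_coeffs "s_hat \<alpha>" by (rule laplacian_coeffs_s_hat) fact+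
  show ?thesis using assms(3,4)
    by (auto simp: tau_kernel_fold_coeff natural_tau_def hankel_correction_def S_hat_mat_def
        toeplitz_def Let_def fold_coeff_def of_nat_diff algebra_simps)
qed

lemma Q_mat_carrier: "Q_mat n \<alpha> \<in> carrier_mat n n"
  by (simp add: Q_mat_def tridiag_def)

lemma natural_tau_carrier: "natural_tau (S_hat_mat n \<alpha>) \<in> carrier_mat n n"
  by (auto simp: natural_tau_def hankel_correction_def S_hat_mat_def toeplitz_def Let_def)

text \<open>Multiplication by \<open>Q_mat\<close> takes a second difference down each column. The
  neighbours missing in the first and last row do no harm, since the column \<open>h\<close> extends
  by zero to positions -1 and n.\<close>

lemma P_alpha_index:
  assumes "0 < \<alpha>" "\<alpha> < 2" "p < n" "q < n"
  shows "P_alpha n \<alpha> $$ (p, q) = tau_kernel (fold_coeff n (s_hat \<alpha>)) p q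
    + \<alpha> / 24 * tau_kernel (second_diff (fold_coeff n (s_hat \<alpha>))) p q"
proof -
  define g where "g = fold_coeff n (s_hat \<alpha>)"
  define h where "h r = g (r - int q) - g (r + int q + 2)" for r
  have entry: "natural_tau (S_hat_mat n \<alpha>) $$ (r, q) = h (int r)" if "r < n" for r
    using that assms by (simp add: natural_tau_index tau_kernel_def g_def h_def)
  have "P_alpha n \<alpha> $$ (p, q) = (\<Sum>r<n. Q_mat n \<alpha> $$ (p, r) * natural_tau (S_hat_mat n \<alpha>) $$ (r, q))"
    using assms Q_mat_carrier[of n \<alpha>] natural_tau_carrier[of n \<alpha>]
    by (simp add: P_alpha_def scalar_prod_def atLeast0LessThan)
  also have "\<dots> = (\<Sum>r<n. (if r = p then (1 + \<alpha> / 12) * h (int r) else 0)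
      - \<alpha> / 24 * ((if p = Suc r then h (int r) else 0) + (if r = Suc p then h (int r) else 0)))"
    using assms(3) by (intro sum.cong refl) (auto simp: entry Q_mat_def tridiag_def algebra_simps)
  also have "\<dots> = (1 + \<alpha> / 12) * h (int p)
      - \<alpha> / 24 * ((\<Sum>r<n. if p = Suc r then h (int r) else 0) + (\<Sum>r<n. if r = Suc p then h (int r) else 0))"
    unfolding sum_subtractf sum_distrib_left[symmetric] sum.distrib using assms(3) by simp
  also have "(\<Sum>r<n. if p = Suc r then h (int r) else 0) = h (int p - 1)"
  proof (cases p)
    case 0
    \<comment> \<open>The two arguments are -(q+1) and q+1, so evenness cancels them.\<close>
    have "h (- 1) = 0"
      using fold_coeff_minus[of n "s_hat \<alpha>" "1 + int q"] by (simp add: h_def g_def add.commute)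
    then show ?thesis using 0 by simp
  next
    case (Suc p')
    then have "(\<Sum>r<n. if p = Suc r then h (int r) else 0) = (\<Sum>r<n. if r = p' then h (int r) else 0)"
      by (intro sum.cong) auto
    then show ?thesis using Suc assms(3) by simp
  qed
  also have "(\<Sum>r<n. if r = Suc p then h (int r) else 0) = h (int p + 1)"
  proof (cases "Suc p < n")
    case True
    then show ?thesis by (simp add: add.commute)
  next
    case False
    then have n: "int p + 1 = int n" using assms(3) by auto
    \<comment> \<open>The two arguments n-q and n+q+2 are mirror images about n+1.\<close>
    have "h (int n) = 0"
      using fold_coeff_reflect[of "int n - int q" n "s_hat \<alpha>"] assms(4)
      by (simp add: h_def g_def algebra_simps)
    then show ?thesis using False n by simp
  qed
  finally show ?thesis
    by (simp add: g_def[symmetric] h_def tau_kernel_def second_diff_def field_simps)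
qed

subsection \<open>Kronecker products and generalised eigenvalues\<close>

abbreviation entries :: "real mat \<Rightarrow> nat \<Rightarrow> nat \<Rightarrow> real" where
  "entries A \<equiv> \<lambda>p q. A $$ (p, q)"

lemma sum_lessThan_mult:
  fixes f :: "nat \<Rightarrow> 'a :: comm_monoid_add"
  shows "(\<Sum>p<m * k. f p) = (\<Sum>i<m. \<Sum>j<k. f (i * k + j))"
proof -
  have "(\<Sum>p<m * k. f p) = (\<Sum>i<m. sum f {i * k..<i * k + k})"
    by (rule sum.nat_group[symmetric])
  also have "\<dots> = (\<Sum>i<m. \<Sum>j<k. f (i * k + j))"
  proof (rule sum.cong[OF refl])
    fix i
    show "sum f {i * k..<i * k + k} = (\<Sum>j<k. f (i * k + j))"
      by (rule sum.reindex_bij_witness[of _ "\<lambda>j. i * k + j" "\<lambda>p. p - i * k"]) auto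
  qed
  finally show ?thesis .
qed

lemma kron_carrier:
  assumes "A \<in> carrier_mat m k" "B \<in> carrier_mat m' k'"
  shows "kron A B \<in> carrier_mat (m * m') (k * k')"
  using assms by (auto simp: kron_def)

lemma mult_add_less: "i * k + j < m * k" if "i < m" "j < (k::nat)"
proof -
  have "i * k + j < Suc i * k" using that by simp
  also have "\<dots> \<le> m * k" using that by (intro mult_right_mono) auto
  finally show ?thesis .
qed

lemma kron_index:
  assumes "A \<in> carrier_mat m m" "B \<in> carrier_mat k k" "i < m" "i' < m" "j < k" "j' < k"
  shows "kron A B $$ (i * k + j, i' * k + j') = A $$ (i, i') * B $$ (j, j')"
  using assms by (simp add: kron_def mult_add_less)

lemma quad_kron_one_left:
  assumes "A \<in> carrier_mat k k"
  shows "quad (m * k) (entries (kron (1\<^sub>m m) A)) x = (\<Sum>i<m. quad k (entries A) (\<lambda>j. x (i * k + j)))"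
proof -
  have "quad (m * k) (entries (kron (1\<^sub>m m) A)) x
    = (\<Sum>i<m. \<Sum>j<k. \<Sum>i'<m. if i' = i then (\<Sum>j'<k. A $$ (j, j') * x (i * k + j) * x (i * k + j')) else 0)"
    unfolding quad_def sum_lessThan_mult
    by (intro sum.cong refl) (use assms in \<open>auto simp: kron_index[OF one_carrier_mat assms] intro!: sum.neutral\<close>)
  also have "\<dots> = (\<Sum>i<m. quad k (entries A) (\<lambda>j. x (i * k + j)))"
    by (simp add: quad_def)
  finally show ?thesis .
qed

text \<open>The index of the identity factor now varies fastest, so the slices of \<open>x\<close>
  have stride m.\<close>

lemma quad_kron_one_right:
  assumes "A \<in> carrier_mat k k"
  shows "quad (k * m) (entries (kron A (1\<^sub>m m))) x = (\<Sum>i<m. quad k (entries A) (\<lambda>j. x (j * m + i)))"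
proof -
  have "quad (k * m) (entries (kron A (1\<^sub>m m))) x
    = (\<Sum>j<k. \<Sum>i<m. \<Sum>j'<k. \<Sum>i'<m. if i' = i then A $$ (j, j') * x (j * m + i) * x (j' * m + i) else 0)"
    unfolding quad_def sum_lessThan_mult
    by (intro sum.cong refl) (use assms in \<open>auto simp: kron_index[OF assms one_carrier_mat]\<close>)
  also have "\<dots> = (\<Sum>j<k. \<Sum>i<m. \<Sum>j'<k. A $$ (j, j') * x (j * m + i) * x (j' * m + i))"
    by simp
  also have "\<dots> = (\<Sum>i<m. quad k (entries A) (\<lambda>j. x (j * m + i)))"
    unfolding quad_def by (rule sum.swap)
  finally show ?thesis .
qed

lemma total_size_split:
  assumes "i \<in> {1..d}"
  shows "total_size d n = size_below n i * n i * size_above d n i"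
proof -
  have "{1..d} = {1..<i} \<union> {i} \<union> {i<..d}" using assms by auto
  then show ?thesis
    unfolding total_size_def size_below_def size_above_def
    by (simp only:) (subst prod.union_disjoint, auto)
qed

text \<open>The form splits over the grid lines in direction i: \<open>v\<close> fixes the
  directions before i and \<open>u\<close> those after it. One-dimensional inequalities therefore
  carry over line by line.\<close>

lemma quad_directional_sum:
  assumes "\<And>i. i \<in> {1..d} \<Longrightarrow> A i \<in> carrier_mat (n i) (n i)"
  shows "quad (total_size d n) (entries (directional_sum d n c A)) x =
    (\<Sum>i\<in>{1..d}. c i * (\<Sum>u<size_above d n i. \<Sum>v<size_below n i.
       quad (n i) (entries (A i)) (\<lambda>j. x ((v * n i + j) * size_above d n i + u))))"
proof -
  let ?B = "\<lambda>i. kron (kron (1\<^sub>m (size_below n i)) (A i)) (1\<^sub>m (size_above d n i))"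
  let ?N = "total_size d n"
  have inner: "kron (1\<^sub>m (size_below n i)) (A i) \<in> carrier_mat (size_below n i * n i) (size_below n i * n i)"
    if "i \<in> {1..d}" for i
    using that by (intro kron_carrier assms) auto
  have B: "?B i \<in> carrier_mat ?N ?N" if "i \<in> {1..d}" for i
    unfolding total_size_split[OF that] by (intro kron_carrier[OF inner[OF that]] one_carrier_mat)
  have "quad ?N (entries (directional_sum d n c A)) x
      = quad ?N (\<lambda>p q. \<Sum>i\<in>{1..d}. c i * ?B i $$ (p, q)) x"
    by (rule quad_cong) (auto simp: directional_sum_def carrier_matD[OF B] intro!: sum.cong)
  also have "\<dots> = (\<Sum>i\<in>{1..d}. c i * quad ?N (entries (?B i)) x)"
  proof -
    have "(\<Sum>p<?N. \<Sum>q<?N. (\<Sum>i\<in>{1..d}. c i * ?B i $$ (p, q)) * x p * x q)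
      = (\<Sum>p<?N. \<Sum>q<?N. \<Sum>i\<in>{1..d}. c i * (?B i $$ (p, q) * x p * x q))"
      by (simp add: sum_distrib_right mult.assoc)
    also have "\<dots> = (\<Sum>p<?N. \<Sum>i\<in>{1..d}. \<Sum>q<?N. c i * (?B i $$ (p, q) * x p * x q))"
      by (intro sum.cong refl sum.swap)
    also have "\<dots> = (\<Sum>i\<in>{1..d}. \<Sum>p<?N. \<Sum>q<?N. c i * (?B i $$ (p, q) * x p * x q))"
      by (rule sum.swap)
    finally show ?thesis by (simp add: quad_def sum_distrib_left)
  qed
  also have "quad ?N (entries (?B i)) x = (\<Sum>u<size_above d n i. \<Sum>v<size_below n i.
       quad (n i) (entries (A i)) (\<lambda>j. x ((v * n i + j) * size_above d n i + u)))"
    if "i \<in> {1..d}" for i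
    unfolding total_size_split[OF that] quad_kron_one_right[OF inner[OF that]]
      quad_kron_one_left[OF assms[OF that]] ..
  then have "(\<Sum>i\<in>{1..d}. c i * quad ?N (entries (?B i)) x) = (\<Sum>i\<in>{1..d}. c i * (\<Sum>u<size_above d n i. \<Sum>v<size_below n i.
       quad (n i) (entries (A i)) (\<lambda>j. x ((v * n i + j) * size_above d n i + u))))"
    by (intro sum.cong refl) simp
  finally show ?thesis .
qed

lemma quad_directional_sum_mono:
  assumes "\<And>i. i \<in> {1..d} \<Longrightarrow> A i \<in> carrier_mat (n i) (n i)"
    and "\<And>i. i \<in> {1..d} \<Longrightarrow> B i \<in> carrier_mat (n i) (n i)"
    and "\<And>i. i \<in> {1..d} \<Longrightarrow> 0 \<le> c i"
    and "\<And>i y. i \<in> {1..d} \<Longrightarrow> s * quad (n i) (entries (A i)) y \<le> t * quad (n i) (entries (B i)) y"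
  shows "s * quad (total_size d n) (entries (directional_sum d n c A)) x
    \<le> t * quad (total_size d n) (entries (directional_sum d n c B)) x"
proof -
  let ?Q = "\<lambda>X. \<Sum>i\<in>{1..d}. c i * (\<Sum>u<size_above d n i. \<Sum>v<size_below n i.
    quad (n i) (entries (X i)) (\<lambda>j. x ((v * n i + j) * size_above d n i + u)))"
  have "s * (c i * (\<Sum>u<U. \<Sum>v<V. quad (n i) (entries (A i)) (y u v)))
      \<le> t * (c i * (\<Sum>u<U. \<Sum>v<V. quad (n i) (entries (B i)) (y u v)))"
    if "i \<in> {1..d}" for i and U V :: nat and y
  proof -
    have "c i * (\<Sum>u<U. \<Sum>v<V. s * quad (n i) (entries (A i)) (y u v))
      \<le> c i * (\<Sum>u<U. \<Sum>v<V. t * quad (n i) (entries (B i)) (y u v))"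
      using that by (intro mult_left_mono sum_mono assms(3,4))
    then show ?thesis by (simp add: mult.left_commute flip: sum_distrib_left)
  qed
  then have "s * ?Q A \<le> t * ?Q B"
    unfolding sum_distrib_left[of s] sum_distrib_left[of t] by (intro sum_mono)
  moreover have "quad (total_size d n) (entries (directional_sum d n c A)) x = ?Q A"
    by (rule quad_directional_sum) (rule assms(1))
  moreover have "quad (total_size d n) (entries (directional_sum d n c B)) x = ?Q B"
    by (rule quad_directional_sum) (rule assms(2))
  ultimately show ?thesis by simp
qed

lemma directional_sum_sym:
  assumes "\<And>i. i \<in> {1..d} \<Longrightarrow> A i \<in> carrier_mat (n i) (n i)"
    and "\<And>i p q. i \<in> {1..d} \<Longrightarrow> p < n i \<Longrightarrow> q < n i \<Longrightarrow> A i $$ (p, q) = A i $$ (q, p)"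
    and "p < total_size d n" "q < total_size d n"
  shows "directional_sum d n c A $$ (p, q) = directional_sum d n c A $$ (q, p)"
proof -
  have kron_sym: "kron X Y $$ (p, q) = kron X Y $$ (q, p)"
    if "X \<in> carrier_mat m m" "Y \<in> carrier_mat k k" "p < m * k" "q < m * k"
      and X: "\<And>p q. p < m \<Longrightarrow> q < m \<Longrightarrow> X $$ (p, q) = X $$ (q, p)"
      and Y: "\<And>p q. p < k \<Longrightarrow> q < k \<Longrightarrow> Y $$ (p, q) = Y $$ (q, p)"
    for X Y :: "real mat" and m k p q
  proof -
    have "k > 0" using that(3) by (cases k) auto
    then have "p div k < m" "q div k < m" "p mod k < k" "q mod k < k"
      using that(3,4) by (auto simp: less_mult_imp_div_less)
    then show ?thesis using that by (auto simp: kron_def)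
  qed
  have "kron (kron (1\<^sub>m (size_below n i)) (A i)) (1\<^sub>m (size_above d n i)) $$ (p, q)
      = kron (kron (1\<^sub>m (size_below n i)) (A i)) (1\<^sub>m (size_above d n i)) $$ (q, p)"
    if i: "i \<in> {1..d}" for i
  proof (rule kron_sym)
    show "kron (1\<^sub>m (size_below n i)) (A i) \<in> carrier_mat (size_below n i * n i) (size_below n i * n i)"
      using assms(1)[OF i] by (intro kron_carrier) auto
    show "kron (1\<^sub>m (size_below n i)) (A i) $$ (p, q) = kron (1\<^sub>m (size_below n i)) (A i) $$ (q, p)"
      if "p < size_below n i * n i" "q < size_below n i * n i" for p q
      by (rule kron_sym[OF one_carrier_mat assms(1)[OF i] that]) (use assms(2)[OF i] in auto)
  qed (use assms(3,4) total_size_split[OF i, of n] in auto)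
  moreover have "dim_row (kron (kron (1\<^sub>m (size_below n i)) (A i)) (1\<^sub>m (size_above d n i))) = total_size d n"
    "dim_col (kron (kron (1\<^sub>m (size_below n i)) (A i)) (1\<^sub>m (size_above d n i))) = total_size d n"
    if i: "i \<in> {1..d}" for i
    using assms(1)[OF i] total_size_split[OF i, of n] by (auto simp: kron_def)
  ultimately show ?thesis
    using assms(3,4) by (auto simp: directional_sum_def intro!: sum.cong)
qed

section \<open>Eigenvalue bounds from quadratic forms\<close>

text \<open>The mixed terms of real and imaginary parts cancel by symmetry, so complex eigenvectors
  can be tested with real forms.\<close>

lemma hermitian_form_real_sym:
  fixes f :: "nat \<Rightarrow> nat \<Rightarrow> real" and v :: "nat \<Rightarrow> complex"
  assumes "\<And>p q. p < n \<Longrightarrow> q < n \<Longrightarrow> f p q = f q p"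
  shows "(\<Sum>p<n. cnj (v p) * (\<Sum>q<n. of_real (f p q) * v q))
    = of_real (quad n f (\<lambda>p. Re (v p)) + quad n f (\<lambda>p. Im (v p)))"
proof (rule complex_eqI)
  have "(\<Sum>p<n. \<Sum>q<n. f p q * Re (v p) * Im (v q)) = (\<Sum>q<n. \<Sum>p<n. f p q * Re (v p) * Im (v q))"
    by (rule sum.swap)
  also have "\<dots> = (\<Sum>p<n. \<Sum>q<n. f p q * Im (v p) * Re (v q))"
    by (intro sum.cong refl) (simp add: assms mult_ac)
  finally show "Im (\<Sum>p<n. cnj (v p) * (\<Sum>q<n. of_real (f p q) * v q))
    = Im (of_real (quad n f (\<lambda>p. Re (v p)) + quad n f (\<lambda>p. Im (v p))))"
    by (simp add: Re_sum Im_sum sum_distrib_left sum_subtractf sum.distrib mult_ac)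
  show "Re (\<Sum>p<n. cnj (v p) * (\<Sum>q<n. of_real (f p q) * v q))
    = Re (of_real (quad n f (\<lambda>p. Re (v p)) + quad n f (\<lambda>p. Im (v p))))"
    by (simp add: Re_sum Im_sum quad_def sum_distrib_left sum.distrib mult_ac)
qed

text \<open>Positivity makes \<open>P\<close> invertible, so an eigenvector satisfies A v = ev P v.
  Pairing with the conjugate of v shows that \<open>ev\<close> is a quotient of real forms.\<close>

lemma eigenvalue_preconditioned_bounds:
  fixes A P :: "real mat" and ev :: complex
  assumes A: "A \<in> carrier_mat N N" and P: "P \<in> carrier_mat N N"
    and symA: "\<And>p q. p < N \<Longrightarrow> q < N \<Longrightarrow> A $$ (p, q) = A $$ (q, p)"
    and symP: "\<And>p q. p < N \<Longrightarrow> q < N \<Longrightarrow> P $$ (p, q) = P $$ (q, p)"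
    and pos: "\<And>x j. j < N \<Longrightarrow> x j \<noteq> 0 \<Longrightarrow> 0 < quad N (entries P) x"
    and lower: "\<And>x. \<mu> * quad N (entries P) x \<le> quad N (entries A) x"
    and upper: "\<And>x. quad N (entries A) x \<le> \<nu> * quad N (entries P) x"
    and ev: "eigenvalue (map_mat complex_of_real (preconditioned P A)) ev"
  shows "ev \<in> \<real> \<and> \<mu> \<le> Re ev \<and> Re ev \<le> \<nu>"
proof -
  \<comment> \<open>A nonzero kernel vector would make the positive form vanish.\<close>
  have "det P \<noteq> 0"
  proof
    assume "det P = 0"
    then obtain v where v: "v \<in> carrier_vec N" "v \<noteq> 0\<^sub>v N" "P *\<^sub>v v = 0\<^sub>v N"
      using det_0_iff_vec_prod_zero[OF P] by auto
    obtain j where j: "j < N" "v $ j \<noteq> 0" using v(1,2) by (metis carrier_vecD eq_vecI index_zero_vec)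
    have "(\<Sum>q<N. P $$ (p, q) * v $ q) = 0" if "p < N" for p
    proof -
      have "(P *\<^sub>v v) $ p = 0" using v(3) that by simp
      then show ?thesis using P v(1) that by (simp add: scalar_prod_def atLeast0LessThan)
    qed
    then have "(\<Sum>p<N. v $ p * (\<Sum>q<N. P $$ (p, q) * v $ q)) = 0" by simp
    then have "quad N (entries P) (\<lambda>p. v $ p) = 0"
      by (simp add: quad_def sum_distrib_left mult_ac)
    then show False using pos[of j "\<lambda>p. v $ p"] j by simp
  qed
  then have "P \<in> Units (ring_mat TYPE(real) N ())"
    by (rule det_non_zero_imp_unit[OF P])
  then obtain B where inv: "mat_inverse P = Some B"
    using mat_inverse(1)[OF P, of "()"] by (cases "mat_inverse P") auto
  then have B: "P * B = 1\<^sub>m N" "B \<in> carrier_mat N N" using mat_inverse(2)[OF P] by auto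
  have BA: "preconditioned P A = B * A" by (simp add: preconditioned_def inv)
  let ?c = "map_mat complex_of_real"
  obtain v where v: "v \<in> carrier_vec N" "v \<noteq> 0\<^sub>v N" "?c (B * A) *\<^sub>v v = ev \<cdot>\<^sub>v v"
    using ev A B unfolding BA eigenvalue_def eigenvector_def by auto
  have "?c A *\<^sub>v v = ?c (P * (B * A)) *\<^sub>v v"
  proof -
    have "P * (B * A) = A" using B A P by (simp flip: assoc_mult_mat)
    then show ?thesis by simp
  qed
  also have "\<dots> = ?c P *\<^sub>v (?c (B * A) *\<^sub>v v)"
    using A B P v(1) by (simp add: of_real_hom.mat_hom_mult[of P N N _ N] assoc_mult_mat_vec[of _ N N _ N])
  also have "\<dots> = ev \<cdot>\<^sub>v (?c P *\<^sub>v v)"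
    using v P by (simp add: mult_mat_vec)
  finally have eq: "?c A *\<^sub>v v = ev \<cdot>\<^sub>v (?c P *\<^sub>v v)" .
  have row: "(\<Sum>q<N. of_real (A $$ (p, q)) * v $ q) = ev * (\<Sum>q<N. of_real (P $$ (p, q)) * v $ q)"
    if "p < N" for p
  proof -
    have "(?c A *\<^sub>v v) $ p = (ev \<cdot>\<^sub>v (?c P *\<^sub>v v)) $ p" by (simp only: eq)
    then show ?thesis using that A P v(1) by (simp add: scalar_prod_def atLeast0LessThan)
  qed
  have pull: "(\<Sum>p<N. f p * (ev * g p)) = ev * (\<Sum>p<N. f p * g p)" for f g
    by (simp add: sum_distrib_left mult.left_commute)
  define x y where "x = (\<lambda>p. Re (v $ p))" and "y = (\<lambda>p. Im (v $ p))"
  define qA qP where "qA = quad N (entries A) x + quad N (entries A) y"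
    and "qP = quad N (entries P) x + quad N (entries P) y"
  have "complex_of_real qA = (\<Sum>p<N. cnj (v $ p) * (\<Sum>q<N. of_real (A $$ (p, q)) * v $ q))"
    unfolding qA_def x_def y_def by (rule hermitian_form_real_sym[symmetric]) (rule symA)
  also have "\<dots> = (\<Sum>p<N. cnj (v $ p) * (ev * (\<Sum>q<N. of_real (P $$ (p, q)) * v $ q)))"
    by (intro sum.cong refl) (simp add: row)
  also have "\<dots> = ev * (\<Sum>p<N. cnj (v $ p) * (\<Sum>q<N. of_real (P $$ (p, q)) * v $ q))"
    by (rule pull)
  also have "\<dots> = ev * of_real qP"
    unfolding qP_def x_def y_def by (subst hermitian_form_real_sym) (auto intro: symP)
  finally have rayleigh: "of_real qA = ev * of_real qP" .
  have nonneg: "0 \<le> quad N (entries P) z" for z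
  proof (cases "\<exists>j<N. z j \<noteq> 0")
    case True
    then show ?thesis using pos less_imp_le by blast
  next
    case False
    then show ?thesis by (simp add: quad_def)
  qed
  obtain j where "j < N" "v $ j \<noteq> 0" using v(1,2) by (metis carrier_vecD eq_vecI index_zero_vec)
  \<comment> \<open>A nonzero complex entry has a nonzero real or imaginary part.\<close>
  then have "0 < quad N (entries P) x \<or> 0 < quad N (entries P) y"
    using pos[of j x] pos[of j y] by (auto simp: x_def y_def complex_eq_iff)
  then have qP: "0 < qP" using nonneg[of x] nonneg[of y] by (auto simp: qP_def)
  then have "ev = of_real (qA / qP)" using rayleigh by (simp add: field_simps)
  moreover have "\<mu> * qP \<le> qA" "qA \<le> \<nu> * qP"
    using lower[of x] lower[of y] upper[of x] upper[of y] by (auto simp: qA_def qP_def distrib_left)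
  ultimately show ?thesis using qP by (simp add: pos_le_divide_eq pos_divide_le_eq del: of_real_divide)
qed

subsection \<open>The preconditioned system\<close>

lemma grid_point_in_box:
  assumes "\<And>i. i \<in> {1..d} \<Longrightarrow> a i < b i" "\<And>i. i \<in> {1..d} \<Longrightarrow> n i > 0"
  shows "grid_point d a b n p \<in> box_domain d a b"
proof -
  have "a i + real (multi_index d n p i) * space_step a b n i \<in> {a i<..<b i}" if "i \<in> {1..d}" for i
  proof -
    define j where "j = multi_index d n p i"
    have j: "0 < real j" "real j < real (n i) + 1"
      using assms(2)[OF that] mod_less_divisor[of "n i" "p div size_above d n i"]
      by (auto simp: j_def multi_index_def)
    have "real j * (b i - a i) < (real (n i) + 1) * (b i - a i)"
      using j assms(1)[OF that] by (intro mult_strict_right_mono) auto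
    then have "real j * space_step a b n i < b i - a i"
      by (simp add: space_step_def divide_simps mult.commute)
    moreover have "0 < real j * space_step a b n i"
      using j assms(1)[OF that] by (auto simp: space_step_def)
    ultimately show ?thesis by (simp add: j_def)
  qed
  then show ?thesis by (auto simp: box_domain_def grid_point_def)
qed

lemma half_time_in:
  assumes "Tf > 0" "m < M"
  shows "half_time Tf M m \<in> {0<..Tf}"
proof -
  have "(real m + 1 / 2) * Tf \<le> real M * Tf" using assms by (intro mult_right_mono) auto
  moreover have "0 < (real m + 1 / 2) * Tf" using assms by simp
  ultimately show ?thesis using assms by (simp add: half_time_def time_step_def divide_simps mult_ac)
qed

lemma quad_mat_diag: "quad n (entries (mat_diag n f)) x = (\<Sum>p<n. f p * (x p)\<^sup>2)"
proof -
  have "quad n (entries (mat_diag n f)) x = (\<Sum>p<n. \<Sum>q<n. if q = p then f p * (x p)\<^sup>2 else 0)"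
    unfolding quad_def by (intro sum.cong refl) (auto simp: mat_diag_def power2_eq_square)
  then show ?thesis by simp
qed

theorem theorem3p1:
  fixes d M m :: nat
    and a b \<alpha> K :: "nat \<Rightarrow> real"
    and n :: "nat \<Rightarrow> nat"
    and r :: "(nat \<Rightarrow> real) \<Rightarrow> real \<Rightarrow> real"
    and Tf rbar c C :: real
    and ev :: complex
  assumes "d \<ge> 1"
    and "\<And>i. i \<in> {1..d} \<Longrightarrow> \<alpha> i \<in> {1<..<2}"
    and "\<And>i. i \<in> {1..d} \<Longrightarrow> K i > 0"
    and "\<And>i. i \<in> {1..d} \<Longrightarrow> a i < b i"
    and "\<And>i. i \<in> {1..d} \<Longrightarrow> n i > 0"
    and "Tf > 0"
    and "c > 0"
    and "\<And>x t. x \<in> box_domain d a b \<Longrightarrow> t \<in> {0<..Tf} \<Longrightarrow> c \<le> r x t \<and> r x t \<le> C"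
    and "M > 0" and "m < M"
    and "r_check d a b r (half_time Tf M m) \<le> rbar"
    and "rbar \<le> r_hat d a b r (half_time Tf M m)"
    and "eigenvalue (map_mat complex_of_real
           (preconditioned (P_tau d a b \<alpha> K n Tf M rbar)
              (D_mat d a b n r (half_time Tf M m) + T_mat d a b \<alpha> K n Tf M))) ev"
  shows "ev \<in> \<real> \<and>
     min (r_check d a b r (half_time Tf M m) / r_hat d a b r (half_time Tf M m)) (3 / 8) \<le> Re ev \<and>
     Re ev \<le> max (r_hat d a b r (half_time Tf M m) / r_check d a b r (half_time Tf M m)) 2"
proof -
  define t where "t = half_time Tf M m"
  define N where "N = total_size d n"
  define lo hi where "lo = r_check d a b r t" and "hi = r_hat d a b r t"
  define A where "A = D_mat d a b n r t + T_mat d a b \<alpha> K n Tf M"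
  define P where "P = P_tau d a b \<alpha> K n Tf M rbar"
  define \<eta> where "\<eta> = eta a b \<alpha> K n Tf M"
  define \<rho> where "\<rho> p = r (grid_point d a b n p) t" for p
  have \<alpha>: "1 < \<alpha> i" "\<alpha> i < 2" "0 < \<alpha> i" if "i \<in> {1..d}" for i
    using assms(2)[OF that] by auto
  have r_bounds: "c \<le> r x t" "r x t \<le> C" if "x \<in> box_domain d a b" for x
    using assms(8)[OF that half_time_in[OF assms(6,10)]] by (auto simp: t_def)
  have grid: "grid_point d a b n p \<in> box_domain d a b" for p
    using assms(4,5) by (intro grid_point_in_box)
  have bdd: "bdd_below ((\<lambda>x. r x t) ` box_domain d a b)" "bdd_above ((\<lambda>x. r x t) ` box_domain d a b)"
    using r_bounds by (auto intro!: bdd_belowI2[of _ c] bdd_aboveI2[of _ _ C])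
  have \<rho>: "lo \<le> \<rho> p" "\<rho> p \<le> hi" for p
    unfolding \<rho>_def lo_def hi_def r_check_def r_hat_def
    using grid bdd by (auto intro: cINF_lower cSUP_upper)
  \<comment> \<open>The grid points show that the box is nonempty, so its infimum inherits the lower
    bound.\<close>
  have "c \<le> lo"
    unfolding lo_def r_check_def using grid r_bounds by (intro cINF_greatest) auto
  then have lo: "0 < lo" using assms(7) by simp
  have rbar: "lo \<le> rbar" "rbar \<le> hi" using assms(11,12) by (auto simp: lo_def hi_def t_def)
  then have hi: "0 < hi" "0 < rbar" using lo by auto
  have \<eta>_nonneg: "0 \<le> \<eta> i" if "i \<in> {1..d}" for i
    using assms(3)[OF that] assms(6) by (auto simp: \<eta>_def eta_def time_step_def)
  have S_carrier: "S_mat (n i) (\<alpha> i) \<in> carrier_mat (n i) (n i)" for i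
    by (simp add: S_mat_def toeplitz_def)
  have P_carrier: "P_alpha (n i) (\<alpha> i) \<in> carrier_mat (n i) (n i)" for i
    unfolding P_alpha_def by (rule mult_carrier_mat[OF Q_mat_carrier natural_tau_carrier])
  define qT qtau where "qT = quad N (entries (T_mat d a b \<alpha> K n Tf M))"
    and "qtau = quad N (entries (tau_T d a b \<alpha> K n Tf M))"
  have equiv: "0 \<le> quad (n i) (entries (P_alpha (n i) (\<alpha> i))) x"
    "3 / 8 * quad (n i) (entries (P_alpha (n i) (\<alpha> i))) x \<le> quad (n i) (entries (S_mat (n i) (\<alpha> i))) x"
    "quad (n i) (entries (S_mat (n i) (\<alpha> i))) x \<le> 2 * quad (n i) (entries (P_alpha (n i) (\<alpha> i))) x"
    if i: "i \<in> {1..d}" for i x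
  proof -
    note ai = \<alpha>[OF i]
    interpret laplacian_coeffs "s_hat (\<alpha> i)" using ai by (intro laplacian_coeffs_s_hat)
    have k: "0 \<le> \<alpha> i / 24" "\<alpha> i / 24 \<le> 1 / 12" using ai by auto
    have S: "quad (n i) (entries (S_mat (n i) (\<alpha> i))) x
        = quad (n i) (\<lambda>p q. s_hat (\<alpha> i) (int p - int q) + \<alpha> i / 24 * second_diff (s_hat (\<alpha> i)) (int p - int q)) x"
      by (rule quad_cong) (rule S_mat_index[OF ai(1,2)])
    have P: "quad (n i) (entries (P_alpha (n i) (\<alpha> i))) x
        = quad (n i) (\<lambda>p q. tau_kernel (fold_coeff (n i) (s_hat (\<alpha> i))) p q
            + \<alpha> i / 24 * tau_kernel (second_diff (fold_coeff (n i) (s_hat (\<alpha> i)))) p q) x"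
      by (rule quad_cong) (rule P_alpha_index[OF ai(3,2)])
    show "0 \<le> quad (n i) (entries (P_alpha (n i) (\<alpha> i))) x"
      "3 / 8 * quad (n i) (entries (P_alpha (n i) (\<alpha> i))) x \<le> quad (n i) (entries (S_mat (n i) (\<alpha> i))) x"
      "quad (n i) (entries (S_mat (n i) (\<alpha> i))) x \<le> 2 * quad (n i) (entries (P_alpha (n i) (\<alpha> i))) x"
      unfolding S P by (rule spectral_equivalence[OF assms(5)[OF i] k])+
  qed
  \<comment> \<open>Monotonicity with both families equal and factors 0 and 1 expresses
    nonnegativity.\<close>
  have qtau_nonneg: "0 \<le> qtau x" for x
    using quad_directional_sum_mono[of d "\<lambda>i. P_alpha (n i) (\<alpha> i)" n "\<lambda>i. P_alpha (n i) (\<alpha> i)" \<eta> 0 1 x]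
      P_carrier \<eta>_nonneg equiv(1) by (simp add: qtau_def N_def tau_T_def \<eta>_def)
  have qT_lower: "3 / 8 * qtau x \<le> qT x" for x
    using quad_directional_sum_mono[of d "\<lambda>i. P_alpha (n i) (\<alpha> i)" n "\<lambda>i. S_mat (n i) (\<alpha> i)" \<eta> "3 / 8" 1 x]
      P_carrier S_carrier \<eta>_nonneg equiv(2) by (simp add: qtau_def qT_def N_def tau_T_def T_mat_def \<eta>_def)
  have qT_upper: "qT x \<le> 2 * qtau x" for x
    using quad_directional_sum_mono[of d "\<lambda>i. S_mat (n i) (\<alpha> i)" n "\<lambda>i. P_alpha (n i) (\<alpha> i)" \<eta> 1 2 x]
      P_carrier S_carrier \<eta>_nonneg equiv(3) by (simp add: qtau_def qT_def N_def tau_T_def T_mat_def \<eta>_def)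
  have carriers: "D_mat d a b n r t \<in> carrier_mat N N" "T_mat d a b \<alpha> K n Tf M \<in> carrier_mat N N"
    "tau_T d a b \<alpha> K n Tf M \<in> carrier_mat N N"
    by (auto simp: D_mat_def T_mat_def tau_T_def directional_sum_def N_def)
  define sq where "sq x = (\<Sum>p<N. (x p)\<^sup>2)" for x :: "nat \<Rightarrow> real"
  have qA: "quad N (entries A) x = (\<Sum>p<N. \<rho> p * (x p)\<^sup>2) + qT x" for x
  proof -
    have "quad N (entries A) x = quad N (\<lambda>p q. D_mat d a b n r t $$ (p, q) + T_mat d a b \<alpha> K n Tf M $$ (p, q)) x"
      by (rule quad_cong) (use carriers in \<open>simp add: A_def\<close>)
    then show ?thesis
      by (simp add: quad_add qT_def D_mat_def quad_mat_diag \<rho>_def flip: N_def)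
  qed
  have qP: "quad N (entries P) x = rbar * sq x + qtau x" for x
  proof -
    have "quad N (entries P) x = quad N (\<lambda>p q. mat_diag N (\<lambda>p. rbar) $$ (p, q) + tau_T d a b \<alpha> K n Tf M $$ (p, q)) x"
      by (rule quad_cong) (use carriers in \<open>auto simp: P_def P_tau_def mat_diag_def simp flip: N_def\<close>)
    then show ?thesis
      by (simp add: quad_add qtau_def quad_mat_diag sq_def sum_distrib_left)
  qed
  have sq_nonneg: "0 \<le> sq x" for x by (auto simp: sq_def intro: sum_nonneg)
  have rho_lower: "lo * sq x \<le> (\<Sum>p<N. \<rho> p * (x p)\<^sup>2)" and rho_upper: "(\<Sum>p<N. \<rho> p * (x p)\<^sup>2) \<le> hi * sq x" for x
    unfolding sq_def sum_distrib_left using \<rho> by (auto intro!: sum_mono mult_right_mono)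
  have "ev \<in> \<real> \<and> min (lo / hi) (3 / 8) \<le> Re ev \<and> Re ev \<le> max (hi / lo) 2"
  proof (rule eigenvalue_preconditioned_bounds)
    show "A \<in> carrier_mat N N" "P \<in> carrier_mat N N"
      using carriers by (auto simp: A_def P_def P_tau_def simp flip: N_def)
    show "A $$ (p, q) = A $$ (q, p)" if pq: "p < N" "q < N" for p q
    proof -
      have "T_mat d a b \<alpha> K n Tf M $$ (p, q) = T_mat d a b \<alpha> K n Tf M $$ (q, p)"
        unfolding T_mat_def
      proof (rule directional_sum_sym)
        fix i p q assume i: "i \<in> {1..d}" and p: "p < n i" and q: "q < n i"
        interpret laplacian_coeffs "s_hat (\<alpha> i)" using \<alpha>[OF i] by (intro laplacian_coeffs_s_hat)
        show "S_mat (n i) (\<alpha> i) $$ (p, q) = S_mat (n i) (\<alpha> i) $$ (q, p)"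
          using even[of "int p - int q"] even[of "int p - int q - 1"] even[of "int p - int q + 1"]
          by (simp add: S_mat_index[OF \<alpha>(1,2)[OF i]] p q second_diff_def algebra_simps)
      qed (use S_carrier pq in \<open>auto simp: N_def\<close>)
      then show ?thesis using pq carriers by (auto simp: A_def D_mat_def mat_diag_def simp flip: N_def)
    qed
    show "P $$ (p, q) = P $$ (q, p)" if pq: "p < N" "q < N" for p q
    proof -
      have "tau_T d a b \<alpha> K n Tf M $$ (p, q) = tau_T d a b \<alpha> K n Tf M $$ (q, p)"
        unfolding tau_T_def
      proof (rule directional_sum_sym)
        fix i p q assume i: "i \<in> {1..d}" and p: "p < n i" and q: "q < n i"
        show "P_alpha (n i) (\<alpha> i) $$ (p, q) = P_alpha (n i) (\<alpha> i) $$ (q, p)"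
          \<comment> \<open>The product of \<open>Q_mat\<close> and the tau matrix is symmetric
            because its entries come from tau kernels of even functions.\<close>
          using fold_coeff_minus[of "n i" "s_hat (\<alpha> i)" "int p - int q"]
            fold_coeff_minus[of "n i" "s_hat (\<alpha> i)" "int p - int q - 1"]
            fold_coeff_minus[of "n i" "s_hat (\<alpha> i)" "int p - int q + 1"]
          by (simp add: P_alpha_index[OF \<alpha>(3,2)[OF i]] p q tau_kernel_def second_diff_def algebra_simps)
      qed (use P_carrier pq in \<open>auto simp: N_def\<close>)
      then show ?thesis using pq carriers by (auto simp: P_def P_tau_def simp flip: N_def)
    qed
    show "0 < quad N (entries P) x" if "j < N" "x j \<noteq> 0" for x j
    proof -
      have "0 < sq x" unfolding sq_def using that by (intro sum_pos2[of _ j]) auto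
      then show ?thesis using qtau_nonneg[of x] hi by (simp add: qP add_pos_nonneg)
    qed
    show "min (lo / hi) (3 / 8) * quad N (entries P) x \<le> quad N (entries A) x" for x
    proof -
      \<comment> \<open>The diagonal part and the tau part are compared separately: the first
        argument of the minimum serves the former, using \<open>rbar\<close> \<le>
        \<open>hi\<close>, and 3/8 serves the latter.\<close>
      have "min (lo / hi) (3 / 8) * rbar \<le> lo / hi * hi"
        using lo hi rbar by (intro mult_mono) auto
      then have "min (lo / hi) (3 / 8) * rbar * sq x \<le> lo * sq x"
        using hi sq_nonneg[of x] by (intro mult_right_mono) auto
      moreover have "min (lo / hi) (3 / 8) * qtau x \<le> 3 / 8 * qtau x"
        by (rule mult_right_mono[OF min.cobounded2 qtau_nonneg])
      ultimately show ?thesis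
        using rho_lower[of x] qT_lower[of x] unfolding qA qP distrib_left by linarith
    qed
    show "quad N (entries A) x \<le> max (hi / lo) 2 * quad N (entries P) x" for x
    proof -
      \<comment> \<open>Dually, \<open>rbar\<close> \<ge> \<open>lo\<close> handles the diagonal
        part and 2 handles the tau part.\<close>
      have "hi / lo * lo \<le> max (hi / lo) 2 * rbar"
        using lo hi rbar by (intro mult_mono) auto
      then have "hi * sq x \<le> max (hi / lo) 2 * rbar * sq x"
        using lo sq_nonneg[of x] by (intro mult_right_mono) auto
      moreover have "2 * qtau x \<le> max (hi / lo) 2 * qtau x"
        by (rule mult_right_mono[OF max.cobounded2 qtau_nonneg])
      ultimately show ?thesis
        using rho_upper[of x] qT_upper[of x] unfolding qA qP distrib_left by linarith
    qed
    show "eigenvalue (map_mat complex_of_real (preconditioned P A)) ev"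
      using assms(13) by (simp add: A_def P_def t_def)
  qed
  then show ?thesis by (simp add: lo_def hi_def t_def)
qed

end
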